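(* Let $k$ be fixed. Let $A\sim P_{\theta^*,z^*}$ be generated from a stochastic block model with $n$ nodes and $k$ communities in the dense regime ($\rho_n\equiv1$), and suppose that: (A1) there exists $C_1>0$ such that $\min_{1\le a\le k} n_a\ge C_1 n/k$ for all $n$; (A2) any two rows of $\theta^*$ are distinct; (A3) the entries of $\theta^*$ are uniformly bounded away from $0$ and $1$. Then, as $n\to\infty$, $$2\Big(\max_{z\in[k]^n}\sup_{\theta\in\Theta_k}\log f(A|\theta,z)-\log f(A|\theta^*,z^* )\Big)\ \stackrel{d}{\rightarrow}\ \chi^2_{\frac{k(k+1)}{2}} .$$
   Context: Setting: $n\to\infty$. For a label vector $z\in[k]^n$ (i.e. $z:[n]\to[k]$) and a symmetric matrix $\theta=(\theta_{ab})_{1\le a,b\le k}$ with entries in $[0,1]$ (identified with an element of $\Theta_k=[0,1]^{k(k+1)/2}$), $A\sim P_{\theta,z}$ means that $A\in\{0,1\}^{n\times n}$ is symmetric with zero diagonal and $(A_{ij})_{i<j}$ are independent Bernoulli variables with $P(A_{ij}=1)=\theta_{z(i)z(j)}$. The log-likelihood is $\log f(A|\theta,z)=\sum_{1\le a\le b\le k}\big(m_{ab}\log\theta_{ab}+(n_{ab}-m_{ab})\log(1-\theta_{ab})\big)$, where $n_a=\sum_i\mathbf 1\{z(i)=a\}$; for $a\ne b$, $n_{ab}=n_an_b$ and $m_{ab}=\sum_{i}\sum_{j\ne i}A_{ij}\mathbf 1\{z(i)=a,z(j)=b\}$; $n_{aa}=n_a(n_a-1)/2$ and $m_{aa}=\sum_{i<j}A_{ij}\mathbf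 1\{z(i)=z(j)=a\}$ (with $0\log 0=0$). The true parameter is $(\theta^*,z^* )$ with $k$ communities; in (A1), $n_a$ is computed at $z^*$. The regime $\rho_n\equiv1$ means that the overall density of the network does not vanish (no sparsity scaling of $\theta^*$). $\chi^2_d$ is the chi-square distribution with $d$ degrees of freedom. *)

theory Defs
  imports "HOL-Probability.Probability"
begin

(* Nodes are {..<n} and communities are {..<k}. Label vectors are extensional functions, so that
   labellings n k is a finite set with k ^ n elements. *)

definition labellings :: "nat \<Rightarrow> nat \<Rightarrow> (nat \<Rightarrow> nat) set" where
  "labellings n k = {..<n} \<rightarrow>\<^sub>E {..<k}"

(* Only the entries with a, b < k are constrained; the others never enter the likelihood. *)
definition sbm_params :: "nat \<Rightarrow> (nat \<Rightarrow> nat \<Rightarrow> real) set" where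
  "sbm_params k = {\<theta>. \<forall>a<k. \<forall>b<k. \<theta> a b = \<theta> b a \<and> 0 \<le> \<theta> a b \<and> \<theta> a b \<le> 1}"

definition node_pairs :: "nat \<Rightarrow> (nat \<times> nat) set" where
  "node_pairs n = {(i, j). i < j \<and> j < n}"

(* Measurability of the entries is part of indep_vars. *)
definition sbm :: "'w measure \<Rightarrow> nat \<Rightarrow> (nat \<Rightarrow> nat \<Rightarrow> real) \<Rightarrow> (nat \<Rightarrow> nat) \<Rightarrow>
    ('w \<Rightarrow> nat \<Rightarrow> nat \<Rightarrow> real) \<Rightarrow> bool" where
  "sbm M n \<theta> z A \<longleftrightarrow>
     prob_space M \<and>
     (\<forall>\<omega>\<in>space M. \<forall>i<n. A \<omega> i i = 0 \<and> (\<forall>j<n. A \<omega> i j \<in> {0, 1} \<and> A \<omega> i j = A \<omega> j i)) \<and>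
     prob_space.indep_vars M (\<lambda>_. borel) (\<lambda>(i, j) \<omega>. A \<omega> i j) (node_pairs n) \<and>
     (\<forall>(i, j)\<in>node_pairs n. measure M {\<omega>\<in>space M. A \<omega> i j = 1} = \<theta> (z i) (z j))"

definition comm_size :: "nat \<Rightarrow> (nat \<Rightarrow> nat) \<Rightarrow> nat \<Rightarrow> nat" where
  "comm_size n z a = card {i\<in>{..<n}. z i = a}"

definition pair_count :: "nat \<Rightarrow> (nat \<Rightarrow> nat) \<Rightarrow> nat \<Rightarrow> nat \<Rightarrow> real" where
  "pair_count n z a b =
     (if a = b then real (comm_size n z a) * (real (comm_size n z a) - 1) / 2
      else real (comm_size n z a) * real (comm_size n z b))"

definition edge_count :: "nat \<Rightarrow> (nat \<Rightarrow> nat \<Rightarrow> real) \<Rightarrow> (nat \<Rightarrow> nat) \<Rightarrow> nat \<Rightarrow> nat \<Rightarrow> real" where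
  "edge_count n A z a b =
     (if a = b then \<Sum>(i, j)\<in>node_pairs n. A i j * of_bool (z i = a \<and> z j = a)
      else \<Sum>i<n. \<Sum>j\<in>{..<n} - {i}. A i j * of_bool (z i = a \<and> z j = b))"

(* ln 0 = 0 in the library, which would be wrong here: parameters on the boundary of [0,1] that
   contradict the data must get log-likelihood -\<infinity>. The convention 0 log 0 = 0 is the
   multiplication of ereal, where 0 * -\<infinity> = 0. *)
definition elog :: "real \<Rightarrow> ereal" where
  "elog x = (if x = 0 then -\<infinity> else ereal (ln x))"

definition sbm_loglik :: "nat \<Rightarrow> nat \<Rightarrow> (nat \<Rightarrow> nat \<Rightarrow> real) \<Rightarrow> (nat \<Rightarrow> nat \<Rightarrow> real) \<Rightarrow>
    (nat \<Rightarrow> nat) \<Rightarrow> ereal" where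
  "sbm_loglik k n A \<theta> z =
     (\<Sum>(a, b)\<in>{(a, b). a \<le> b \<and> b < k}.
        ereal (edge_count n A z a b) * elog (\<theta> a b) +
        ereal (pair_count n z a b - edge_count n A z a b) * elog (1 - \<theta> a b))"

definition sbm_max_loglik :: "nat \<Rightarrow> nat \<Rightarrow> (nat \<Rightarrow> nat \<Rightarrow> real) \<Rightarrow> ereal" where
  "sbm_max_loglik k n A =
     (MAX z\<in>labellings n k. SUP \<theta>\<in>sbm_params k. sbm_loglik k n A \<theta> z)"

(* Both terms are finite whenever the entries of \<theta> lie strictly between 0 and 1
   (see the lemma sbm_loglik_finite), so real_of_ereal loses nothing. *)
definition sbm_lr_stat :: "nat \<Rightarrow> nat \<Rightarrow> (nat \<Rightarrow> nat \<Rightarrow> real) \<Rightarrow> (nat \<Rightarrow> nat) \<Rightarrow>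
    (nat \<Rightarrow> nat \<Rightarrow> real) \<Rightarrow> real" where
  "sbm_lr_stat k n \<theta> z A =
     2 * (real_of_ereal (sbm_max_loglik k n A) - real_of_ereal (sbm_loglik k n A \<theta> z))"

definition chi_square_distribution :: "nat \<Rightarrow> real measure" where
  "chi_square_distribution d =
     distr (PiM {..<d} (\<lambda>_. std_normal_distribution)) borel (\<lambda>x. \<Sum>i<d. (x i)\<^sup>2)"

lemma finite_block_pairs: "finite {(a, b). a \<le> b \<and> b < (k::nat)}"
  by (rule finite_subset[of _ "{..<k} \<times> {..<k}"]) auto

lemma finite_node_pairs: "finite (node_pairs n)"
  unfolding node_pairs_def by (rule finite_subset[of _ "{..<n} \<times> {..<n}"]) auto

lemma elog_nonpos: "0 \<le> x \<Longrightarrow> x \<le> 1 \<Longrightarrow> elog x \<le> 0"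
  by (auto simp: elog_def)

lemma edge_count_bounds:
  assumes "\<And>i j. i < n \<Longrightarrow> j < n \<Longrightarrow> A i j \<in> {0, 1}"
  shows "0 \<le> edge_count n A z a b" and "edge_count n A z a b \<le> pair_count n z a b"
proof -
  have A: "0 \<le> A i j" "A i j \<le> 1" if "i < n" "j < n" for i j
    using assms[OF that] by auto
  show "0 \<le> edge_count n A z a b"
    unfolding edge_count_def node_pairs_def
    by (auto intro!: sum_nonneg A simp: case_prod_beta)
  show "edge_count n A z a b \<le> pair_count n z a b"
  proof (cases "a = b")
    case True
    define C where "C = {i\<in>{..<n}. z i = a}"
    have fin: "finite C" by (simp add: C_def)
    define P where "P = {p\<in>node_pairs n. z (fst p) = a \<and> z (snd p) = a}"
    have "edge_count n A z a b \<le> (\<Sum>p\<in>node_pairs n. of_bool (z (fst p) = a \<and> z (snd p) = a))"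
      unfolding edge_count_def using True
      by (auto intro!: sum_mono A simp: case_prod_beta node_pairs_def of_bool_def)
    also have "\<dots> = real (card P)"
      unfolding P_def using finite_node_pairs[of n]
      by (subst sum_of_bool_eq) (auto simp: Int_def)
    also have "card P = card {K. K \<subseteq> C \<and> card K = 2}"
    proof (rule bij_betw_same_card[of "\<lambda>(i, j). {i, j}"], rule bij_betwI')
      fix p q assume "p \<in> P" "q \<in> P"
      then show "((case p of (i, j) \<Rightarrow> {i, j}) = (case q of (i, j) \<Rightarrow> {i, j})) = (p = q)"
        by (auto simp: P_def node_pairs_def doubleton_eq_iff)
    next
      fix p assume "p \<in> P"
      then show "(case p of (i, j) \<Rightarrow> {i, j}) \<in> {K. K \<subseteq> C \<and> card K = 2}"
        by (auto simp: P_def node_pairs_def C_def)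
    next
      fix K assume "K \<in> {K. K \<subseteq> C \<and> card K = 2}"
      then obtain i j where ij: "K = {i, j}" "i \<noteq> j" "i \<in> C" "j \<in> C"
        by (auto simp: card_2_iff)
      show "\<exists>p\<in>P. K = (case p of (i, j) \<Rightarrow> {i, j})"
        using ij by (intro bexI[of _ "(min i j, max i j)"])
          (auto simp: P_def node_pairs_def C_def min_def max_def)
    qed
    also have "\<dots> = card C choose 2"
      using n_subsets[OF fin] .
    also have "real (card C choose 2) = pair_count n z a b"
    proof -
      have "real (card C choose 2) = real (card C) * (real (card C) - 1) / 2"
      proof (cases "card C")
        case (Suc m)
        have "real (card C choose 2) = real (Suc m * m div 2)"
          by (simp only: Suc choose_two diff_Suc_1)
        also have "\<dots> = real (Suc m * m) / 2"
          using real_of_nat_div[of 2 "Suc m * m"] by simp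
        finally show ?thesis by (simp add: Suc algebra_simps)
      qed simp
      then show ?thesis
        using True by (simp add: pair_count_def comm_size_def C_def)
    qed
    finally show ?thesis .
  next
    case False
    have "edge_count n A z a b \<le> (\<Sum>i<n. \<Sum>j\<in>{..<n} - {i}. of_bool (z i = a \<and> z j = b))"
      unfolding edge_count_def if_not_P[OF False]
      by (intro sum_mono) (simp add: of_bool_def A)
    also have "\<dots> \<le> (\<Sum>i<n. \<Sum>j<n. of_bool (z i = a) * of_bool (z j = b))"
      by (intro sum_mono order_trans[OF sum_mono2[of "{..<n}"]]) (auto intro!: sum_mono)
    also have "\<dots> = real (\<Sum>i<n. of_bool (z i = a)) * real (\<Sum>j<n. of_bool (z j = b))"
      unfolding of_nat_sum of_nat_of_bool by (rule sum_product[symmetric])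
    also have "\<dots> = pair_count n z a b"
      using False
      by (simp del: of_nat_sum add: pair_count_def comm_size_def Int_def)
    finally show ?thesis .
  qed
qed

lemma sbm_loglik_nonpos:
  assumes "\<And>i j. i < n \<Longrightarrow> j < n \<Longrightarrow> A i j \<in> {0, 1}" and "\<theta> \<in> sbm_params k"
  shows "sbm_loglik k n A \<theta> z \<le> 0"
  unfolding sbm_loglik_def
proof (rule sum_nonpos, clarify)
  fix a b :: nat assume "a \<le> b" "b < k"
  then have "0 \<le> \<theta> a b" "\<theta> a b \<le> 1"
    using assms(2) by (auto simp: sbm_params_def)
  then show "ereal (edge_count n A z a b) * elog (\<theta> a b) +
      ereal (pair_count n z a b - edge_count n A z a b) * elog (1 - \<theta> a b) \<le> 0"
    using edge_count_bounds[of n A z a b, OF assms(1)]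
    by (intro add_nonpos_nonpos) (auto intro!: mult_nonneg_nonpos elog_nonpos
        simp: ereal_mult_le_0_iff)
qed

lemma sbm_loglik_finite:
  assumes A: "\<And>i j. i < n \<Longrightarrow> j < n \<Longrightarrow> A i j \<in> {0, 1}"
    and \<theta>: "\<theta> \<in> sbm_params k" "\<forall>a<k. \<forall>b<k. 0 < \<theta> a b \<and> \<theta> a b < 1"
    and z: "z \<in> labellings n k"
  shows "\<bar>sbm_loglik k n A \<theta> z\<bar> \<noteq> \<infinity>" and "\<bar>sbm_max_loglik k n A\<bar> \<noteq> \<infinity>"
proof -
  have "sbm_loglik k n A \<theta> z = (\<Sum>p\<in>{(a, b). a \<le> b \<and> b < k}. ereal
      (edge_count n A z (fst p) (snd p) * ln (\<theta> (fst p) (snd p)) +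
       (pair_count n z (fst p) (snd p) - edge_count n A z (fst p) (snd p)) *
         ln (1 - \<theta> (fst p) (snd p))))"
    unfolding sbm_loglik_def
  proof (rule sum.cong[OF refl], clarsimp)
    fix a b :: nat assume "a \<le> b" "b < k"
    then have "a < k" by simp
    with \<open>b < k\<close> \<theta>(2) have "0 < \<theta> a b" "\<theta> a b < 1" by blast+
    then have "\<theta> a b \<noteq> 0" "1 - \<theta> a b \<noteq> 0" by auto
    then show "ereal (edge_count n A z a b) * elog (\<theta> a b) +
        ereal (pair_count n z a b - edge_count n A z a b) * elog (1 - \<theta> a b) =
        ereal (edge_count n A z a b * ln (\<theta> a b) +
          (pair_count n z a b - edge_count n A z a b) * ln (1 - \<theta> a b))"
      by (simp add: elog_def)
  qed
  then show fin: "\<bar>sbm_loglik k n A \<theta> z\<bar> \<noteq> \<infinity>"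
    by simp
  have finL: "finite (labellings n k)"
    by (simp add: labellings_def finite_PiE)
  have "sbm_loglik k n A \<theta> z \<le> (SUP \<theta>\<in>sbm_params k. sbm_loglik k n A \<theta> z)"
    using \<theta>(1) by (rule SUP_upper)
  also have "\<dots> \<le> sbm_max_loglik k n A"
    unfolding sbm_max_loglik_def using finL z by (intro Max_ge) auto
  finally have lower: "sbm_loglik k n A \<theta> z \<le> sbm_max_loglik k n A" .
  have "sbm_loglik k n A \<theta>' z' \<le> 0" if "\<theta>' \<in> sbm_params k" for \<theta>' z'
    using A that by (rule sbm_loglik_nonpos)
  then have upper: "sbm_max_loglik k n A \<le> 0"
    unfolding sbm_max_loglik_def using finL z
    by (subst Max_le_iff) (auto intro!: SUP_least)
  show "\<bar>sbm_max_loglik k n A\<bar> \<noteq> \<infinity>"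
    using fin lower upper by (cases "sbm_max_loglik k n A") auto
qed

end

theory Submission
  imports Defs "HOL-Real_Asymp.Real_Asymp"
begin

text \<open>For a labelling \<open>z\<close> that is not a relabelling of the truth and a parameter \<open>\<eta>\<close>, Markov's inequality
  for the square root of the likelihood ratio bounds the probability that \<open>(\<eta>, z)\<close> beats the truth by
  \<open>exp (- D / 4)\<close>, where \<open>D\<close> is the squared distance between the two edge probability matrices. Since the
  rows of the true parameter are distinct, \<open>D\<close> is at least of order \<open>n\<close> times the Hamming
  distance from \<open>z\<close> to the closest relabelling of the truth. The maximising \<open>\<eta>\<close> for a given \<open>z\<close>
  is a vector of frequencies and so has only polynomially many possible values; a union bound over
  \<open>\<eta>\<close> and \<open>z\<close> therefore shows that with probability tending to one the true labelling is a maximiser.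

  On that event the statistic is a sum over the \<open>k (k + 1) / 2\<close> blocks of independent binomial
  likelihood ratio statistics. Each converges to the square of a standard normal variable, by the
  central limit theorem and the second-order expansion of the Kullback--Leibler divergence, and the
  sum is handled by multiplying characteristic functions.\<close>

section \<open>Regrouping edges by blocks\<close>

definition blocks :: "nat \<Rightarrow> (nat \<times> nat) set" where
  "blocks k = {(a, b). a \<le> b \<and> b < k}"

text \<open>An unordered pair of labels is encoded by its sorted version, so that a pair
  \<open>i < j\<close> with \<open>z i > z j\<close> still lands in \<open>blocks k\<close>.\<close>

definition block :: "(nat \<Rightarrow> nat) \<Rightarrow> nat \<times> nat \<Rightarrow> nat \<times> nat" where
  "block z p = (min (z (fst p)) (z (snd p)), max (z (fst p)) (z (snd p)))"

definition block_pairs :: "nat \<Rightarrow> (nat \<Rightarrow> nat) \<Rightarrow> nat \<times> nat \<Rightarrow> (nat \<times> nat) set" where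
  "block_pairs n z q = {p \<in> node_pairs n. block z p = q}"

lemma finite_blocks [simp]: "finite (blocks k)"
  unfolding blocks_def by (rule finite_block_pairs)

lemma finite_block_pairs_block [simp]: "finite (block_pairs n z q)"
  unfolding block_pairs_def using finite_node_pairs[of n] by simp

lemma card_blocks: "card (blocks k) = k * (k + 1) div 2"
proof -
  have "blocks k = prod.swap ` (SIGMA b:{..<k}. {..b})"
    by (auto simp: blocks_def image_iff)
  then have "card (blocks k) = card (SIGMA b:{..<k}. {..b})"
    by (simp add: card_image)
  also have "\<dots> = (\<Sum>b<k. Suc b)" by simp
  also have "\<dots> = k * (k + 1) div 2"
    by (induction k) auto
  finally show ?thesis .
qed

lemma block_in_blocks:
  assumes "z \<in> labellings n k" "p \<in> node_pairs n"
  shows "block z p \<in> blocks k"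
proof -
  have "fst p < n" "snd p < n" using assms(2) by (auto simp: node_pairs_def)
  then have "z (fst p) < k" "z (snd p) < k"
    using assms(1) by (auto simp: labellings_def)
  then show ?thesis by (auto simp: block_def blocks_def)
qed

text \<open>Every ordered pair of distinct nodes is a pair with \<open>i < j\<close> or the mirror
  image of one. This converts the double sums of \<open>edge_count\<close> and of the distance
  estimate into sums over \<open>node_pairs\<close>.\<close>

lemma sum_off_diagonal:
  fixes F :: "nat \<Rightarrow> nat \<Rightarrow> 'a :: comm_monoid_add"
  shows "(\<Sum>i<n. \<Sum>j\<in>{..<n} - {i}. F i j) = (\<Sum>p\<in>node_pairs n. F (fst p) (snd p) + F (snd p) (fst p))"
proof -
  have fin: "finite (node_pairs n)" by (rule finite_node_pairs)
  have "(\<Sum>i<n. \<Sum>j\<in>{..<n} - {i}. F i j) = (\<Sum>p\<in>(SIGMA i:{..<n}. {..<n} - {i}). F (fst p) (snd p))"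
    by (simp add: sum.Sigma split_def)
  also have "(SIGMA i:{..<n}. {..<n} - {i}) = node_pairs n \<union> prod.swap ` node_pairs n"
    by (auto simp: node_pairs_def image_iff)
  also have "(\<Sum>p\<in>node_pairs n \<union> prod.swap ` node_pairs n. F (fst p) (snd p)) =
     (\<Sum>p\<in>node_pairs n. F (fst p) (snd p)) + (\<Sum>p\<in>prod.swap ` node_pairs n. F (fst p) (snd p))"
    using fin by (intro sum.union_disjoint) (auto simp: node_pairs_def)
  also have "(\<Sum>p\<in>prod.swap ` node_pairs n. F (fst p) (snd p)) = (\<Sum>p\<in>node_pairs n. F (snd p) (fst p))"
    by (subst sum.reindex) (auto simp: o_def)
  finally show ?thesis by (simp add: sum.distrib)
qed

text \<open>For \<open>a < b\<close> the double sum runs over ordered pairs and meets each node pair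
  of the block in exactly one of its two orientations; symmetry of \<open>A\<close> makes the
  orientation immaterial.\<close>

lemma edge_count_eq_sum:
  assumes "\<And>i j. i < n \<Longrightarrow> j < n \<Longrightarrow> A i j = A j i" and "a \<le> b"
  shows "edge_count n A z a b = (\<Sum>p\<in>block_pairs n z (a, b). A (fst p) (snd p))"
proof -
  have "edge_count n A z a b = (\<Sum>p\<in>node_pairs n. A (fst p) (snd p) * of_bool (block z p = (a, b)))"
  proof (cases "a = b")
    case True
    then show ?thesis
      by (auto simp: edge_count_def split_def block_def min_def max_def intro!: sum.cong)
  next
    case False
    have "edge_count n A z a b = (\<Sum>p\<in>node_pairs n. A (fst p) (snd p) * of_bool (z (fst p) = a \<and> z (snd p) = b)
        + A (snd p) (fst p) * of_bool (z (snd p) = a \<and> z (fst p) = b))"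
      unfolding edge_count_def if_not_P[OF False]
      by (rule sum_off_diagonal[of "\<lambda>i j. A i j * of_bool (z i = a \<and> z j = b)"])
    also have "\<dots> = (\<Sum>p\<in>node_pairs n. A (fst p) (snd p) * of_bool (block z p = (a, b)))"
    proof (rule sum.cong[OF refl])
      fix p assume "p \<in> node_pairs n"
      then have "A (snd p) (fst p) = A (fst p) (snd p)"
        using assms(1) by (auto simp: node_pairs_def)
      then show "A (fst p) (snd p) * of_bool (z (fst p) = a \<and> z (snd p) = b)
        + A (snd p) (fst p) * of_bool (z (snd p) = a \<and> z (fst p) = b) = A (fst p) (snd p) * of_bool (block z p = (a, b))"
        using False assms(2) by (auto simp: block_def min_def max_def)
    qed
    finally show ?thesis .
  qed
  also have "\<dots> = (\<Sum>p\<in>block_pairs n z (a, b). A (fst p) (snd p))"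
    unfolding block_pairs_def using finite_node_pairs[of n]
    by (auto simp: sum.inter_filter of_bool_def intro!: sum.cong)
  finally show ?thesis .
qed

text \<open>Edge counting in the complete graph: with all entries 1 the previous identity gives the
  cardinality, and expanding the product of the two community sizes gives the formula.\<close>

lemma pair_count_eq_card:
  assumes "a \<le> b"
  shows "pair_count n z a b = real (card (block_pairs n z (a, b)))"
proof -
  have "real (card (block_pairs n z (a, b))) = edge_count n (\<lambda>_ _. 1) z a b"
    using assms by (subst edge_count_eq_sum) auto
  also have "\<dots> = pair_count n z a b"
  proof -
    define x where "x c i = (of_bool (z i = c) :: real)" for c i
    have size: "real (comm_size n z c) = (\<Sum>i<n. x c i)" for c
      by (simp add: comm_size_def x_def Int_def)
    have prod: "real (comm_size n z a) * real (comm_size n z b) =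
      (\<Sum>i<n. \<Sum>j\<in>{..<n} - {i}. x a i * x b j) + (\<Sum>i<n. x a i * x b i)"
    proof -
      have "real (comm_size n z a) * real (comm_size n z b) = (\<Sum>i<n. \<Sum>j<n. x a i * x b j)"
        unfolding size by (rule sum_product)
      also have "\<dots> = (\<Sum>i<n. x a i * x b i + (\<Sum>j\<in>{..<n} - {i}. x a i * x b j))"
        by (intro sum.cong refl sum.remove) auto
      finally show ?thesis by (simp add: sum.distrib add.commute)
    qed
    show ?thesis
    proof (cases "a = b")
      case True
      have "x b i * x b i = x b i" for i by (simp add: x_def)
      then have diag: "(\<Sum>i<n. x b i * x b i) = real (comm_size n z b)"
        unfolding size by (simp only:)
      then have "real (comm_size n z b) * real (comm_size n z b) =
          2 * (\<Sum>p\<in>node_pairs n. x b (fst p) * x b (snd p)) + real (comm_size n z b)"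
        using prod True sum_off_diagonal[of "\<lambda>i j. x b i * x b j" n]
        by (simp add: sum_distrib_left mult.commute)
      moreover have "edge_count n (\<lambda>_ _. 1) z b b = (\<Sum>p\<in>node_pairs n. x b (fst p) * x b (snd p))"
        by (auto simp: edge_count_def split_def x_def intro!: sum.cong)
      ultimately show ?thesis
        using True by (simp add: pair_count_def algebra_simps)
    next
      case False
      then have "(\<Sum>i<n. x a i * x b i) = 0"
        by (intro sum.neutral) (auto simp: x_def)
      moreover have "edge_count n (\<lambda>_ _. 1) z a b = (\<Sum>i<n. \<Sum>j\<in>{..<n} - {i}. x a i * x b j)"
        using False by (auto simp: edge_count_def x_def intro!: sum.cong)
      ultimately show ?thesis
        using False prod by (simp add: pair_count_def)
    qed
  qed
  finally show ?thesis by simp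
qed

lemma card_block_pairs_le: "card (block_pairs n z q) \<le> n\<^sup>2"
proof -
  have "block_pairs n z q \<subseteq> {..<n} \<times> {..<n}"
    by (auto simp: block_pairs_def node_pairs_def)
  then have "card (block_pairs n z q) \<le> card ({..<n} \<times> {..<n})"
    by (rule card_mono[rotated]) auto
  then show ?thesis by (simp add: power2_eq_square)
qed

lemma sum_node_pairs_block:
  assumes "z \<in> labellings n k"
  shows "(\<Sum>q\<in>blocks k. \<Sum>p\<in>block_pairs n z q. f p) = (\<Sum>p\<in>node_pairs n. f p)"
  unfolding block_pairs_def
  by (rule sum.group) (use assms finite_node_pairs block_in_blocks in auto)

section \<open>The profile likelihood\<close>

definition bernoulli_loglik :: "real \<Rightarrow> real \<Rightarrow> real \<Rightarrow> real" where
  "bernoulli_loglik N m x = m * ln x + (N - m) * ln (1 - x)"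

text \<open>The junk values \<^term>\<open>ln 0 = 0\<close> and \<^term>\<open>0 / 0 = 0\<close> on the
  right-hand side are harmless: they are multiplied by \<^term>\<open>0\<close>.\<close>

lemma gibbs:
  assumes "0 \<le> m" "m \<le> N" "0 \<le> x" "x \<le> 1"
  shows "ereal m * elog x + ereal (N - m) * elog (1 - x) \<le> ereal (bernoulli_loglik N m (m / N))"
proof -
  \<comment> \<open>This is \<open>ln u \<le> u - 1\<close> with \<open>u = y * N / c\<close>,
    scaled by \<open>c\<close>. When the inequalities for edges and non-edges are added, the linear
    terms \<open>N * (c / N - y)\<close> cancel.\<close>
  have term_le: "c * ln y + N * (c / N - y) \<le> c * ln (c / N)" if "0 < c" "0 < y" "0 < N" for c y
  proof -
    have "ln (y / (c / N)) \<le> y / (c / N) - 1"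
      using that by (intro ln_le_minus_one) auto
    then have "ln y - ln (c / N) \<le> y * N / c - 1"
      using that by (subst (asm) ln_divide_pos) (auto simp: mult.commute)
    then have "c * (ln y - ln (c / N)) \<le> c * (y * N / c - 1)"
      using that by (intro mult_left_mono) auto
    moreover have "c * (y * N / c - 1) = y * N - c" "N * (c / N - y) = c - y * N"
      using that by (simp_all add: field_simps)
    ultimately show ?thesis by (simp add: right_diff_distrib mult.commute)
  qed
  consider "N = 0" | "m = 0" "N > 0" | "m = N" "N > 0" | "0 < m" "m < N" "N > 0"
    using assms by linarith
  then show ?thesis
  proof cases
    case 1
    then show ?thesis using assms by (simp add: bernoulli_loglik_def zero_ereal_def[symmetric])
  next
    case 2
    then show ?thesis using assms elog_nonpos[of "1 - x"]
      by (auto simp: bernoulli_loglik_def zero_ereal_def[symmetric] ereal_mult_le_0_iff)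
  next
    case 3
    then show ?thesis using assms elog_nonpos[of x]
      by (auto simp: bernoulli_loglik_def zero_ereal_def[symmetric] ereal_mult_le_0_iff)
  next
    case 4
    consider "x = 0" | "x = 1" | "0 < x" "x < 1" using assms by linarith
    then show ?thesis
    proof cases
      case 3
      have "1 - m / N = (N - m) / N" using 4 by (simp add: field_simps)
      moreover have "N * (m / N - x) + N * ((N - m) / N - (1 - x)) = 0"
        using 4 by (simp add: field_simps)
      ultimately show ?thesis
        using term_le[of m x] term_le[of "N - m" "1 - x"] 3 4
        by (simp add: elog_def bernoulli_loglik_def)
    qed (use 4 in \<open>auto simp: elog_def\<close>)
  qed
qed

lemma gibbs_eq:
  assumes "0 \<le> m" "m \<le> N"
  shows "ereal m * elog (m / N) + ereal (N - m) * elog (1 - m / N) =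
    ereal (bernoulli_loglik N m (m / N))"
proof (cases "m = 0 \<or> m = N \<or> N = 0")
  case True
  then show ?thesis using assms
    by (auto simp: elog_def bernoulli_loglik_def zero_ereal_def[symmetric])
next
  case False
  then have "m / N \<noteq> 0" "1 - m / N \<noteq> 0" using assms by (auto simp: field_simps)
  then show ?thesis by (simp add: elog_def bernoulli_loglik_def)
qed

definition adjacency :: "nat \<Rightarrow> (nat \<Rightarrow> nat \<Rightarrow> real) \<Rightarrow> bool" where
  "adjacency n A \<longleftrightarrow> (\<forall>i<n. \<forall>j<n. A i j \<in> {0, 1} \<and> A i j = A j i)"

definition block_edges :: "nat \<Rightarrow> (nat \<Rightarrow> nat \<Rightarrow> real) \<Rightarrow> (nat \<Rightarrow> nat) \<Rightarrow> nat \<times> nat \<Rightarrow> real" where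
  "block_edges n A z q = (\<Sum>p\<in>block_pairs n z q. A (fst p) (snd p))"

definition block_freq :: "nat \<Rightarrow> (nat \<Rightarrow> nat \<Rightarrow> real) \<Rightarrow> (nat \<Rightarrow> nat) \<Rightarrow> nat \<times> nat \<Rightarrow> real" where
  "block_freq n A z q = block_edges n A z q / real (card (block_pairs n z q))"

definition profile_loglik :: "nat \<Rightarrow> nat \<Rightarrow> (nat \<Rightarrow> nat \<Rightarrow> real) \<Rightarrow> (nat \<Rightarrow> nat) \<Rightarrow> real" where
  "profile_loglik k n A z =
     (\<Sum>q\<in>blocks k. bernoulli_loglik (card (block_pairs n z q)) (block_edges n A z q) (block_freq n A z q))"

lemma adjacency_node_pairs: "adjacency n A \<Longrightarrow> p \<in> node_pairs n \<Longrightarrow> A (fst p) (snd p) \<in> {0, 1}"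
  by (cases p) (auto simp: adjacency_def node_pairs_def dest: less_trans)

lemma block_edges_bounds:
  assumes "adjacency n A"
  shows "0 \<le> block_edges n A z q" "block_edges n A z q \<le> card (block_pairs n z q)"
proof -
  have A: "0 \<le> A (fst p) (snd p) \<and> A (fst p) (snd p) \<le> 1" if "p \<in> block_pairs n z q" for p
    using adjacency_node_pairs[OF assms, of p] that by (auto simp: block_pairs_def)
  show "0 \<le> block_edges n A z q"
    unfolding block_edges_def using A by (intro sum_nonneg) auto
  show "block_edges n A z q \<le> card (block_pairs n z q)"
    unfolding block_edges_def using A sum_mono[of "block_pairs n z q" "\<lambda>p. A (fst p) (snd p)" "\<lambda>_. 1"] by simp
qed

lemma block_freq_bounds:
  assumes "adjacency n A"
  shows "0 \<le> block_freq n A z q" "block_freq n A z q \<le> 1"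
  using block_edges_bounds[OF assms, of z q] unfolding block_freq_def
  by (auto simp: divide_le_eq_1)

lemma sbm_loglik_eq_blocks:
  assumes "adjacency n A"
  shows "sbm_loglik k n A \<theta> z = (\<Sum>q\<in>blocks k. ereal (block_edges n A z q) * elog (\<theta> (fst q) (snd q)) +
      ereal (card (block_pairs n z q) - block_edges n A z q) * elog (1 - \<theta> (fst q) (snd q)))"
  unfolding sbm_loglik_def blocks_def[symmetric]
proof (rule sum.cong[OF refl])
  fix q assume "q \<in> blocks k"
  then obtain a b where q: "q = (a, b)" "a \<le> b" by (auto simp: blocks_def)
  have "edge_count n A z a b = block_edges n A z q"
    unfolding q block_edges_def using assms q by (intro edge_count_eq_sum) (auto simp: adjacency_def)
  then show "(case q of (a, b) \<Rightarrow> ereal (edge_count n A z a b) * elog (\<theta> a b) +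
          ereal (pair_count n z a b - edge_count n A z a b) * elog (1 - \<theta> a b)) =
     ereal (block_edges n A z q) * elog (\<theta> (fst q) (snd q)) +
      ereal (card (block_pairs n z q) - block_edges n A z q) * elog (1 - \<theta> (fst q) (snd q))"
    using q by (simp add: pair_count_eq_card)
qed

text \<open>Each block has its own parameter, so the supremum is taken blockwise:
  \<open>gibbs\<close> bounds every block and the block frequencies attain all the bounds at
  once.\<close>

lemma SUP_sbm_loglik:
  assumes "adjacency n A"
  shows "(SUP \<theta>\<in>sbm_params k. sbm_loglik k n A \<theta> z) = ereal (profile_loglik k n A z)"
proof (rule antisym)
  note [simp] = block_edges_bounds[OF assms] block_freq_bounds[OF assms]
  show "(SUP \<theta>\<in>sbm_params k. sbm_loglik k n A \<theta> z) \<le> ereal (profile_loglik k n A z)"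
  proof (rule SUP_least)
    fix \<theta> assume \<theta>: "\<theta> \<in> sbm_params k"
    show "sbm_loglik k n A \<theta> z \<le> ereal (profile_loglik k n A z)"
      unfolding sbm_loglik_eq_blocks[OF assms] profile_loglik_def sum_ereal[symmetric]
    proof (rule sum_mono)
      fix q assume "q \<in> blocks k"
      then have "0 \<le> \<theta> (fst q) (snd q)" "\<theta> (fst q) (snd q) \<le> 1"
        using \<theta> by (auto simp: sbm_params_def blocks_def)
      then show "ereal (block_edges n A z q) * elog (\<theta> (fst q) (snd q)) +
      ereal (card (block_pairs n z q) - block_edges n A z q) * elog (1 - \<theta> (fst q) (snd q)) \<le>
        ereal (bernoulli_loglik (card (block_pairs n z q)) (block_edges n A z q) (block_freq n A z q))"
        unfolding block_freq_def by (intro gibbs) simp_all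
    qed
  qed
  \<comment> \<open>Sorting the two labels makes this symmetric, as membership in
    \<open>sbm_params k\<close> demands.\<close>
  define \<theta> where "\<theta> a b = block_freq n A z (min a b, max a b)" for a b
  have "ereal (profile_loglik k n A z) = sbm_loglik k n A \<theta> z"
    unfolding sbm_loglik_eq_blocks[OF assms] profile_loglik_def sum_ereal[symmetric]
    by (intro sum.cong refl)
      (auto simp: blocks_def \<theta>_def block_freq_def gibbs_eq)
  moreover have "\<theta> \<in> sbm_params k"
    by (auto simp: sbm_params_def \<theta>_def min.commute max.commute)
  ultimately show "ereal (profile_loglik k n A z) \<le> (SUP \<theta>\<in>sbm_params k. sbm_loglik k n A \<theta> z)"
    by (metis SUP_upper)
qed

lemma finite_labellings [simp]: "finite (labellings n k)"
  by (simp add: labellings_def finite_PiE)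

lemma sbm_max_loglik_eq:
  assumes "adjacency n A" "labellings n k \<noteq> {}"
  shows "real_of_ereal (sbm_max_loglik k n A) = (MAX z\<in>labellings n k. profile_loglik k n A z)"
proof -
  have "sbm_max_loglik k n A = Max (ereal ` profile_loglik k n A ` labellings n k)"
    unfolding sbm_max_loglik_def SUP_sbm_loglik[OF assms(1)] by (simp add: image_image)
  also have "\<dots> = ereal (MAX z\<in>labellings n k. profile_loglik k n A z)"
    using assms(2) by (intro mono_Max_commute[symmetric]) (auto simp: mono_def)
  finally show ?thesis by simp
qed

section \<open>The likelihood as a product over node pairs\<close>

definition bernoulli_mass :: "real \<Rightarrow> real \<Rightarrow> real" where
  "bernoulli_mass x p = (if x = 1 then p else 1 - p)"

text \<open>The likelihood itself, not its logarithm: a boundary parameter contradicted by the data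
  gives 0 here, and each factor involves a single entry of \<open>A\<close>, so independence can be
  exploited.\<close>

definition block_lik :: "nat \<Rightarrow> (nat \<Rightarrow> nat \<Rightarrow> real) \<Rightarrow> (nat \<times> nat \<Rightarrow> real) \<Rightarrow> (nat \<Rightarrow> nat) \<Rightarrow> real" where
  "block_lik n A \<eta> z = (\<Prod>p\<in>node_pairs n. bernoulli_mass (A (fst p) (snd p)) (\<eta> (block z p)))"

text \<open>Positivity of the observed masses makes the logarithms genuine; the value
  \<open>ln 0 = 0\<close> would break the correspondence.\<close>

lemma block_lik_eq_exp:
  assumes A: "adjacency n A" and z: "z \<in> labellings n k"
    and pos: "\<And>p. p \<in> node_pairs n \<Longrightarrow> 0 < bernoulli_mass (A (fst p) (snd p)) (\<eta> (block z p))"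
  shows "block_lik n A \<eta> z =
    exp (\<Sum>q\<in>blocks k. bernoulli_loglik (card (block_pairs n z q)) (block_edges n A z q) (\<eta> q))"
proof -
  have "bernoulli_loglik (card (block_pairs n z q)) (block_edges n A z q) (\<eta> q) =
     (\<Sum>p\<in>block_pairs n z q. ln (bernoulli_mass (A (fst p) (snd p)) (\<eta> (block z p))))" for q
  proof -
    have "(\<Sum>p\<in>block_pairs n z q. ln (bernoulli_mass (A (fst p) (snd p)) (\<eta> (block z p)))) =
      (\<Sum>p\<in>block_pairs n z q. A (fst p) (snd p) * ln (\<eta> q) + (1 - A (fst p) (snd p)) * ln (1 - \<eta> q))"
    proof (rule sum.cong[OF refl])
      fix p assume "p \<in> block_pairs n z q"
      then have "block z p = q" "A (fst p) (snd p) \<in> {0, 1}"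
        using adjacency_node_pairs[OF A, of p] by (auto simp: block_pairs_def)
      then show "ln (bernoulli_mass (A (fst p) (snd p)) (\<eta> (block z p))) =
        A (fst p) (snd p) * ln (\<eta> q) + (1 - A (fst p) (snd p)) * ln (1 - \<eta> q)"
        by (auto simp: bernoulli_mass_def)
    qed
    then show ?thesis
      by (simp add: bernoulli_loglik_def block_edges_def sum.distrib sum_distrib_right[symmetric]
          sum_subtractf)
  qed
  then have "(\<Sum>q\<in>blocks k. bernoulli_loglik (card (block_pairs n z q)) (block_edges n A z q) (\<eta> q)) =
      (\<Sum>p\<in>node_pairs n. ln (bernoulli_mass (A (fst p) (snd p)) (\<eta> (block z p))))"
    by (simp add: sum_node_pairs_block[OF z])
  then show ?thesis
    unfolding block_lik_def using pos by (simp add: exp_sum finite_node_pairs)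
qed

text \<open>Frequencies equal to 0 or 1 do no harm: a block containing an edge has positive
  frequency and a block containing a non-edge has frequency below 1, so every observed outcome has
  positive mass.\<close>

lemma block_lik_freq:
  assumes A: "adjacency n A" and z: "z \<in> labellings n k"
  shows "block_lik n A (block_freq n A z) z = exp (profile_loglik k n A z)"
  unfolding profile_loglik_def
proof (rule block_lik_eq_exp[OF A z])
  fix p assume p: "p \<in> node_pairs n"
  define B where "B = block_pairs n z (block z p)"
  have pB: "p \<in> B" "finite B" using p by (simp_all add: B_def) (simp add: block_pairs_def)
  then have card: "card B > 0" by (auto simp: card_gt_0_iff)
  have AB: "A (fst r) (snd r) \<in> {0, 1}" if "r \<in> B" for r
    using adjacency_node_pairs[OF A] that by (auto simp: B_def block_pairs_def)
  then have AB': "0 \<le> A (fst r) (snd r) \<and> A (fst r) (snd r) \<le> 1" if "r \<in> B" for r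
    using that by fastforce
  consider "A (fst p) (snd p) = 1" | "A (fst p) (snd p) = 0" using AB[OF pB(1)] by auto
  then show "0 < bernoulli_mass (A (fst p) (snd p)) (block_freq n A z (block z p))"
  proof cases
    case 1
    have "A (fst p) (snd p) \<le> (\<Sum>r\<in>B. A (fst r) (snd r))"
      using pB AB' by (intro member_le_sum) auto
    then show ?thesis
      using 1 card by (simp add: bernoulli_mass_def block_freq_def block_edges_def B_def)
  next
    case 2
    have "1 - A (fst p) (snd p) \<le> (\<Sum>r\<in>B. 1 - A (fst r) (snd r))"
      using pB AB' by (intro member_le_sum[of p B "\<lambda>r. 1 - A (fst r) (snd r)"]) auto
    then show ?thesis
      using 2 card by (simp add: bernoulli_mass_def block_freq_def block_edges_def B_def sum_subtractf)
  qed
qed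

lemma
  assumes A: "adjacency n A" and z: "z \<in> labellings n k"
    and \<theta>: "\<forall>a<k. \<forall>b<k. 0 < \<theta> a b \<and> \<theta> a b < 1"
  shows sbm_loglik_eq_sum: "sbm_loglik k n A \<theta> z = ereal (\<Sum>q\<in>blocks k.
      bernoulli_loglik (card (block_pairs n z q)) (block_edges n A z q) (\<theta> (fst q) (snd q)))" (is ?A)
    and exp_sbm_loglik: "exp (real_of_ereal (sbm_loglik k n A \<theta> z)) = block_lik n A (\<lambda>q. \<theta> (fst q) (snd q)) z" (is ?B)
    and block_lik_pos: "0 < block_lik n A (\<lambda>q. \<theta> (fst q) (snd q)) z" (is ?C)
proof -
  have \<theta>': "0 < \<theta> (fst q) (snd q)" "\<theta> (fst q) (snd q) < 1" if "q \<in> blocks k" for q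
    using \<theta> that by (auto simp: blocks_def)
  show ?A
    unfolding sbm_loglik_eq_blocks[OF A] sum_ereal[symmetric]
  proof (rule sum.cong[OF refl])
    fix q assume "q \<in> blocks k"
    with \<theta>' have "\<theta> (fst q) (snd q) \<noteq> 0" "1 - \<theta> (fst q) (snd q) \<noteq> 0" by fastforce+
    then show "ereal (block_edges n A z q) * elog (\<theta> (fst q) (snd q)) +
        ereal (card (block_pairs n z q) - block_edges n A z q) * elog (1 - \<theta> (fst q) (snd q)) =
      ereal (bernoulli_loglik (card (block_pairs n z q)) (block_edges n A z q) (\<theta> (fst q) (snd q)))"
      by (simp add: elog_def bernoulli_loglik_def)
  qed
  moreover have "block_lik n A (\<lambda>q. \<theta> (fst q) (snd q)) z =
     exp (\<Sum>q\<in>blocks k. bernoulli_loglik (card (block_pairs n z q)) (block_edges n A z q) (\<theta> (fst q) (snd q)))"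
    by (rule block_lik_eq_exp[OF A z])
      (use \<theta>' block_in_blocks[OF z] in \<open>auto simp: bernoulli_mass_def\<close>)
  ultimately show ?B ?C by simp_all
qed

definition relabelling :: "nat \<Rightarrow> nat \<Rightarrow> (nat \<Rightarrow> nat) \<Rightarrow> (nat \<Rightarrow> nat) \<Rightarrow> bool" where
  "relabelling k n z z' \<longleftrightarrow> (\<exists>\<sigma>. bij_betw \<sigma> {..<k} {..<k} \<and> (\<forall>i<n. z i = \<sigma> (z' i)))"

text \<open>A permutation of the labels permutes the blocks and carries their sets of node pairs
  along, so the sum over blocks is only reordered.\<close>

lemma profile_loglik_relabelling:
  assumes z': "z' \<in> labellings n k" and rel: "relabelling k n z z'"
  shows "profile_loglik k n A z = profile_loglik k n A z'"
proof -
  obtain \<sigma> where \<sigma>: "bij_betw \<sigma> {..<k} {..<k}" "\<And>i. i < n \<Longrightarrow> z i = \<sigma> (z' i)"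
    using rel by (auto simp: relabelling_def)
  have \<sigma>_lt: "\<sigma> a < k" if "a < k" for a using \<sigma>(1) that by (auto simp: bij_betw_def)
  have \<sigma>_inj: "\<sigma> a = \<sigma> b \<longleftrightarrow> a = b" if "a < k" "b < k" for a b
    using \<sigma>(1) that by (auto simp: bij_betw_def inj_on_def)
  define \<beta> where "\<beta> = block \<sigma>"
  have inj: "inj_on \<beta> (blocks k)"
  proof (rule inj_onI, clarsimp simp: \<beta>_def blocks_def block_def)
    fix a b c d assume "a \<le> b" "b < k" "c \<le> d" "d < k" 
      "min (\<sigma> a) (\<sigma> b) = min (\<sigma> c) (\<sigma> d)" "max (\<sigma> a) (\<sigma> b) = max (\<sigma> c) (\<sigma> d)"
    then show "a = c \<and> b = d"
      using \<sigma>_inj[of a c] \<sigma>_inj[of a d] \<sigma>_inj[of b c] \<sigma>_inj[of b d] \<sigma>_inj[of a b] \<sigma>_inj[of c d]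
      by (auto simp: min_def max_def split: if_splits)
  qed
  have "\<beta> ` blocks k \<subseteq> blocks k"
    by (auto simp: \<beta>_def blocks_def block_def \<sigma>_lt)
  then have bij: "bij_betw \<beta> (blocks k) (blocks k)"
    using inj by (simp add: bij_betw_def endo_inj_surj)
  have pairs: "block_pairs n z (\<beta> q) = block_pairs n z' q" if "q \<in> blocks k" for q
  proof -
    have "block z p = \<beta> q \<longleftrightarrow> block z' p = q" if p: "p \<in> node_pairs n" for p
    proof -
      have lt: "fst p < n" "snd p < n" using p by (auto simp: node_pairs_def)
      have "block z p = \<beta> (block z' p)"
        using lt by (auto simp: \<beta>_def block_def \<sigma>(2) min_def max_def)
      then show ?thesis
        using inj \<open>q \<in> blocks k\<close> block_in_blocks[OF z' p] by (auto simp: inj_on_def)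
    qed
    then show ?thesis by (auto simp: block_pairs_def)
  qed
  show ?thesis
    unfolding profile_loglik_def block_freq_def block_edges_def
    by (subst sum.reindex_bij_betw[OF bij, symmetric]) (simp add: pairs)
qed

section \<open>Consistency of the labelling\<close>

definition hamming :: "nat \<Rightarrow> (nat \<Rightarrow> nat) \<Rightarrow> (nat \<Rightarrow> nat) \<Rightarrow> nat" where
  "hamming n z z' = card {i \<in> {..<n}. z i \<noteq> z' i}"

text \<open>The factor \<open>m - 1\<close> in place of \<open>m\<close> accounts for the diagonal:
  \<open>T i\<close> may contain \<open>i\<close> itself.\<close>

lemma sum_off_diagonal_ge:
  fixes F :: "nat \<Rightarrow> nat \<Rightarrow> real"
  assumes F: "\<And>i j. 0 \<le> F i j" and v: "0 \<le> v" and m: "1 \<le> m"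
    and S: "S \<subseteq> {..<n}"
    and T: "\<And>i. i \<in> S \<Longrightarrow> T i \<subseteq> {..<n}" "\<And>i. i \<in> S \<Longrightarrow> m \<le> card (T i)"
    and lower: "\<And>i j. i \<in> S \<Longrightarrow> j \<in> T i \<Longrightarrow> v \<le> F i j"
  shows "real (card S) * (real m - 1) * v \<le> (\<Sum>i<n. \<Sum>j\<in>{..<n} - {i}. F i j)"
proof -
  have "real (card S) * ((real m - 1) * v) \<le> (\<Sum>i\<in>S. \<Sum>j\<in>{..<n} - {i}. F i j)"
  proof (rule sum_bounded_below)
    fix i assume i: "i \<in> S"
    have "m - 1 \<le> card (T i - {i})"
      using T(2)[OF i] diff_card_le_card_Diff[of "{i}" "T i"] by simp
    then have "real (m - 1) * v \<le> real (card (T i - {i})) * v"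
      using v by (intro mult_right_mono) simp_all
    also have "\<dots> \<le> (\<Sum>j\<in>T i - {i}. F i j)"
      by (rule sum_bounded_below) (use lower[OF i] in auto)
    also have "\<dots> \<le> (\<Sum>j\<in>{..<n} - {i}. F i j)"
      by (rule sum_mono2) (use T(1)[OF i] F in auto)
    finally show "(real m - 1) * v \<le> (\<Sum>j\<in>{..<n} - {i}. F i j)"
      using m by (simp add: of_nat_diff)
  qed
  also have "\<dots> \<le> (\<Sum>i<n. \<Sum>j\<in>{..<n} - {i}. F i j)"
    using S by (intro sum_mono2 sum_nonneg F) auto
  finally show ?thesis by (simp add: mult.assoc)
qed

text \<open>Send each true community \<open>a\<close> to a label \<open>\<tau> a\<close> that at least \<open>m\<close> of its nodes carry. Either
  \<open>t\<close> is off by \<open>\<delta> / 2\<close> on one of the resulting large cells, or \<open>\<tau>\<close> is a permutation and every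
  node not labelled according to \<open>\<tau>\<close> is off by \<open>\<delta> / 2\<close> on a whole large cell.\<close>

lemma misfit_lower_bound:
  fixes t \<phi> :: "nat \<Rightarrow> nat \<Rightarrow> real"
  assumes k: "1 \<le> k" and z: "z \<in> labellings n k" and z': "z' \<in> labellings n k"
    and \<delta>: "0 < \<delta>" and sep: "\<And>a b. a < k \<Longrightarrow> b < k \<Longrightarrow> a \<noteq> b \<Longrightarrow> \<exists>c<k. \<delta> \<le> \<bar>\<phi> a c - \<phi> b c\<bar>"
    and m: "1 \<le> m" and size: "\<And>a. a < k \<Longrightarrow> k * m \<le> comm_size n z' a"
  obtains \<sigma> where "bij_betw \<sigma> {..<k} {..<k}"
    "\<delta>\<^sup>2 / 4 * (real m - 1) * (real m / real n) * real (hamming n z (\<lambda>i. \<sigma> (z' i))) \<le>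
      (\<Sum>i<n. \<Sum>j\<in>{..<n} - {i}. (t (z i) (z j) - \<phi> (z' i) (z' j))\<^sup>2)"
proof -
  let ?D = "\<Sum>i<n. \<Sum>j\<in>{..<n} - {i}. (t (z i) (z j) - \<phi> (z' i) (z' j))\<^sup>2"
  define cell where "cell b a = {i\<in>{..<n}. z i = b \<and> z' i = a}" for b a
  have cell_sub: "cell b a \<subseteq> {..<n}" for a b by (auto simp: cell_def)
  have ham_le: "hamming n z y \<le> n" for y
    using card_mono[of "{..<n}" "{i \<in> {..<n}. z i \<noteq> y i}"] by (auto simp: hamming_def)
  have sizem: "m \<le> n"
  proof -
    have "m \<le> k * m" using k by simp
    also have "\<dots> \<le> comm_size n z' 0" using size k by simp
    also have "\<dots> \<le> n"
      using card_mono[of "{..<n}" "{i \<in> {..<n}. z' i = 0}"] by (auto simp: comm_size_def)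
    finally show ?thesis .
  qed
  then have n: "0 < n" using m by simp
  have frac: "real m / real n \<le> 1" using sizem n by simp
  \<comment> \<open>Pigeonhole: at least \<open>k * m\<close> nodes of community \<open>a\<close>
    are spread over \<open>k\<close> labels.\<close>
  have "\<forall>a<k. \<exists>b<k. m \<le> card (cell b a)"
  proof (intro allI impI, rule ccontr)
    fix a assume a: "a < k" and "\<not> (\<exists>b<k. m \<le> card (cell b a))"
    then have small: "card (cell b a) < m" if "b < k" for b using that by (auto simp: not_le)
    have "{i\<in>{..<n}. z' i = a} = (\<Union>b\<in>{..<k}. cell b a)"
      using z by (auto simp: cell_def labellings_def)
    then have "comm_size n z' a \<le> (\<Sum>b<k. card (cell b a))"
      unfolding comm_size_def using card_UN_le[of "{..<k}" "\<lambda>b. cell b a"] by simp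
    also have "\<dots> < (\<Sum>b<k. m)"
      using small k by (intro sum_strict_mono) (auto simp: lessThan_empty_iff)
    finally show False using size[OF a] by simp
  qed
  then obtain \<tau> where \<tau>: "\<And>a. a < k \<Longrightarrow> \<tau> a < k" "\<And>a. a < k \<Longrightarrow> m \<le> card (cell (\<tau> a) a)"
    by metis
  have v: "\<delta>\<^sup>2 / 4 \<le> x\<^sup>2" if "\<delta> / 2 \<le> \<bar>x\<bar>" for x :: real
    using power_mono[OF that, of 2] \<delta> by (simp add: power_divide)
  show thesis
  proof (cases "\<exists>e<k. \<exists>c<k. \<delta> / 2 \<le> \<bar>t (\<tau> e) (\<tau> c) - \<phi> e c\<bar>")
    case True
    then obtain e c where ec: "e < k" "c < k" "\<delta> / 2 \<le> \<bar>t (\<tau> e) (\<tau> c) - \<phi> e c\<bar>" by blast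
    have "real (card (cell (\<tau> e) e)) * (real m - 1) * (\<delta>\<^sup>2 / 4) \<le> ?D"
      by (rule sum_off_diagonal_ge[where T = "\<lambda>_. cell (\<tau> c) c"])
        (use m cell_sub \<tau>(2)[OF ec(2)] v[OF ec(3)] in \<open>auto simp: cell_def\<close>)
    moreover have "real m * (real m - 1) * (\<delta>\<^sup>2 / 4) \<le> real (card (cell (\<tau> e) e)) * (real m - 1) * (\<delta>\<^sup>2 / 4)"
      using \<tau>(2)[OF ec(1)] m by (intro mult_right_mono) auto
    \<comment> \<open>A misfit on two large cells already costs \<open>m * (m - 1)\<close> terms.
      The factor \<open>m / n\<close> in the claimed bound is there for this case: any Hamming
      distance is at most \<open>n\<close>, so even the identity permutation will do.\<close>
    moreover have "\<delta>\<^sup>2 / 4 * (real m - 1) * (real m / real n) * real (hamming n z (\<lambda>i. id (z' i)))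
        \<le> \<delta>\<^sup>2 / 4 * (real m - 1) * (real m / real n) * real n"
      using ham_le m by (intro mult_left_mono) auto
    moreover have "\<delta>\<^sup>2 / 4 * (real m - 1) * (real m / real n) * real n = real m * (real m - 1) * (\<delta>\<^sup>2 / 4)"
      using n by (simp add: field_simps)
    ultimately have "\<delta>\<^sup>2 / 4 * (real m - 1) * (real m / real n) * real (hamming n z (\<lambda>i. id (z' i))) \<le> ?D"
      by linarith
    then show thesis using bij_betw_id by (rule that[rotated])
  next
    case False
    then have close: "\<bar>t (\<tau> e) (\<tau> c) - \<phi> e c\<bar> < \<delta> / 2" if "e < k" "c < k" for e c
      using that by (auto simp: not_le)
    \<comment> \<open>If \<open>\<tau>\<close> merged \<open>a\<close> and \<open>b\<close>, one
      value of \<open>t\<close> would lie within \<open>\<delta> / 2\<close> of both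
      \<open>\<phi> a c\<close> and \<open>\<phi> b c\<close>, which are at least
      \<open>\<delta>\<close> apart for a separating \<open>c\<close>.\<close>
    have inj: "inj_on \<tau> {..<k}"
    proof (rule inj_onI, rule ccontr)
      fix a b assume ab: "a \<in> {..<k}" "b \<in> {..<k}" "\<tau> a = \<tau> b" "a \<noteq> b"
      then obtain c where c: "c < k" "\<delta> \<le> \<bar>\<phi> a c - \<phi> b c\<bar>" using sep[of a b] by auto
      moreover have "\<bar>t (\<tau> a) (\<tau> c) - \<phi> a c\<bar> < \<delta> / 2" "\<bar>t (\<tau> a) (\<tau> c) - \<phi> b c\<bar> < \<delta> / 2"
        using close[of a c] close[of b c] ab c by auto
      ultimately show False by linarith
    qed
    have "\<tau> ` {..<k} \<subseteq> {..<k}" using \<tau>(1) by auto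
    with inj have bij: "bij_betw \<tau> {..<k} {..<k}"
      by (simp add: bij_betw_def endo_inj_surj)
    define S where "S = {i \<in> {..<n}. z i \<noteq> \<tau> (z' i)}"
    \<comment> \<open>A wrongly labelled node carries the label of another community
      \<open>a\<close>. In a column \<open>c\<close> separating \<open>a\<close> from its true
      community, \<open>t\<close> is close to \<open>\<phi> a c\<close> and therefore far from the
      true value, for every \<open>j\<close> in the large cell of \<open>c\<close>.\<close>
    have "\<exists>c<k. \<forall>j\<in>cell (\<tau> c) c. \<delta> / 2 \<le> \<bar>t (z i) (z j) - \<phi> (z' i) (z' j)\<bar>" if i: "i \<in> S" for i
    proof -
      have lt: "z i < k" "z' i < k" using i z z' by (auto simp: S_def labellings_def)
      then have "z i \<in> \<tau> ` {..<k}" using bij by (auto simp: bij_betw_def)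
      then obtain a where a: "a < k" "z i = \<tau> a" by auto
      then have "a \<noteq> z' i" using i by (auto simp: S_def)
      then obtain c where c: "c < k" "\<delta> \<le> \<bar>\<phi> a c - \<phi> (z' i) c\<bar>" using sep[of a "z' i"] a lt by auto
      have "\<delta> / 2 \<le> \<bar>t (z i) (\<tau> c) - \<phi> (z' i) c\<bar>"
      proof -
        have "\<bar>t (z i) (\<tau> c) - \<phi> a c\<bar> < \<delta> / 2" using close[of a c] a c by simp
        then show ?thesis using c(2) by linarith
      qed
      then show ?thesis using c(1) by (intro exI[of _ c]) (auto simp: cell_def)
    qed
    then obtain w where w: "\<And>i. i \<in> S \<Longrightarrow> w i < k"
      "\<And>i j. i \<in> S \<Longrightarrow> j \<in> cell (\<tau> (w i)) (w i) \<Longrightarrow> \<delta> / 2 \<le> \<bar>t (z i) (z j) - \<phi> (z' i) (z' j)\<bar>"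
      by metis
    have "real (card S) * (real m - 1) * (\<delta>\<^sup>2 / 4) \<le> ?D"
      by (rule sum_off_diagonal_ge[where T = "\<lambda>i. cell (\<tau> (w i)) (w i)"])
        (use m cell_sub \<tau>(2) w v in \<open>auto simp: S_def\<close>)
    moreover have "card S = hamming n z (\<lambda>i. \<tau> (z' i))"
      by (simp add: S_def hamming_def)
    moreover have "\<delta>\<^sup>2 / 4 * (real m - 1) * (real m / real n) * real (hamming n z (\<lambda>i. \<tau> (z' i)))
       \<le> \<delta>\<^sup>2 / 4 * (real m - 1) * 1 * real (hamming n z (\<lambda>i. \<tau> (z' i)))"
      using frac m by (intro mult_left_mono mult_right_mono) auto
    ultimately have "\<delta>\<^sup>2 / 4 * (real m - 1) * (real m / real n) * real (hamming n z (\<lambda>i. \<tau> (z' i))) \<le> ?D"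
      by (simp only: mult_1_right mult.commute mult.left_commute mult.assoc)
    then show thesis using bij by (rule that[rotated])
  qed
qed

section \<open>Exponential bound for one competitor against the truth\<close>

lemma sqrt_prod: "sqrt (\<Prod>i\<in>I. f i) = (\<Prod>i\<in>I. sqrt (f i))"
  by (induction I rule: infinite_finite_induct) (simp_all add: real_sqrt_mult)

text \<open>The left side is 1 minus half the sum of \<open>(sqrt p - sqrt q)\<^sup>2\<close> and
  its analogue for \<open>1 - p\<close> and \<open>1 - q\<close>. Since
  \<open>sqrt x + sqrt y \<le> 2\<close> on the unit interval, each of these squares is at least
  \<open>(p - q)\<^sup>2 / 4\<close>.\<close>

lemma hellinger_affinity_le:
  fixes p q :: real
  assumes "0 \<le> p" "p \<le> 1" "0 \<le> q" "q \<le> 1"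
  shows "sqrt (p * q) + sqrt ((1 - p) * (1 - q)) \<le> exp (- ((p - q)\<^sup>2 / 4))"
proof -
  have sq: "(x - y)\<^sup>2 / 4 \<le> (sqrt x - sqrt y)\<^sup>2" if "0 \<le> x" "x \<le> 1" "0 \<le> y" "y \<le> 1" for x y :: real
  proof -
    have "x - y = (sqrt x - sqrt y) * (sqrt x + sqrt y)"
      using that by (simp add: algebra_simps)
    then have "(x - y)\<^sup>2 = (sqrt x - sqrt y)\<^sup>2 * (sqrt x + sqrt y)\<^sup>2"
      by (simp add: power_mult_distrib)
    also have "(sqrt x + sqrt y)\<^sup>2 \<le> 2\<^sup>2"
      using that by (intro power_mono) (use add_mono[of "sqrt x" 1 "sqrt y" 1] in auto)
    finally show ?thesis by (simp add: mult_left_mono)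
  qed
  have "(sqrt p - sqrt q)\<^sup>2 = p + q - 2 * sqrt (p * q)"
    "(sqrt (1 - p) - sqrt (1 - q))\<^sup>2 = (1 - p) + (1 - q) - 2 * sqrt ((1 - p) * (1 - q))"
    using assms by (simp_all add: power2_diff real_sqrt_mult)
  moreover have "(p - q)\<^sup>2 / 4 \<le> (sqrt p - sqrt q)\<^sup>2" "((1 - p) - (1 - q))\<^sup>2 / 4 \<le> (sqrt (1 - p) - sqrt (1 - q))\<^sup>2"
    using assms by (intro sq; simp)+
  moreover have "((1 - p) - (1 - q))\<^sup>2 = (p - q)\<^sup>2"
    by (simp add: power2_commute)
  ultimately have "sqrt (p * q) + sqrt ((1 - p) * (1 - q)) \<le> 1 + (- ((p - q)\<^sup>2 / 4))"
    by linarith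
  also have "\<dots> \<le> exp (- ((p - q)\<^sup>2 / 4))" by (rule exp_ge_add_one_self)
  finally show ?thesis .
qed

lemma sbm_adjacency:
  "sbm M n \<phi> z A \<Longrightarrow> \<omega> \<in> space M \<Longrightarrow> adjacency n (A \<omega>)"
  by (auto simp: sbm_def adjacency_def)

lemma sbm_measurable:
  assumes "sbm M n \<phi> z A" "p \<in> node_pairs n"
  shows "(\<lambda>\<omega>. A \<omega> (fst p) (snd p)) \<in> borel_measurable M"
proof -
  interpret prob_space M using assms(1) by (simp add: sbm_def)
  have "indep_vars (\<lambda>_. borel) (\<lambda>(i, j) \<omega>. A \<omega> i j) (node_pairs n)"
    using assms(1) by (simp add: sbm_def)
  then show ?thesis using assms(2) by (auto simp: indep_vars_def split_def)
qed

text \<open>An entry takes two values, so \<open>g\<close> of it is a combination of the indicators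
  of the edge event and its complement. The general codomain covers both real root ratios and
  complex characteristic functions.\<close>

lemma sbm_expectation:
  fixes g :: "real \<Rightarrow> 'b :: {banach, second_countable_topology}"
  assumes sbm: "sbm M n \<phi> z A" and p: "p \<in> node_pairs n"
  shows "(\<integral>\<omega>. g (A \<omega> (fst p) (snd p)) \<partial>M) =
      \<phi> (z (fst p)) (z (snd p)) *\<^sub>R g 1 + (1 - \<phi> (z (fst p)) (z (snd p))) *\<^sub>R g 0"
    and "integrable M (\<lambda>\<omega>. g (A \<omega> (fst p) (snd p)))"
proof -
  interpret prob_space M using sbm by (simp add: sbm_def)
  define X where "X \<omega> = A \<omega> (fst p) (snd p)" for \<omega>
  have [measurable]: "X \<in> borel_measurable M"
    unfolding X_def using sbm p by (rule sbm_measurable)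
  have val: "X \<omega> \<in> {0, 1}" if "\<omega> \<in> space M" for \<omega>
    unfolding X_def by (rule adjacency_node_pairs[OF sbm_adjacency[OF sbm that] p])
  define E where "E = {\<omega> \<in> space M. X \<omega> = 1}"
  have [measurable]: "E \<in> sets M" unfolding E_def by measurable
  have prob: "prob E = \<phi> (z (fst p)) (z (snd p))"
    using sbm p unfolding E_def X_def by (auto simp: sbm_def split_def)
  have eq: "g (X \<omega>) = indicator E \<omega> *\<^sub>R g 1 + indicator (space M - E) \<omega> *\<^sub>R g 0" if "\<omega> \<in> space M" for \<omega>
    using val[OF that] that by (auto simp: E_def)
  have int: "has_bochner_integral M (\<lambda>\<omega>. indicator E \<omega> *\<^sub>R g 1 + indicator (space M - E) \<omega> *\<^sub>R g 0)
      (prob E *\<^sub>R g 1 + prob (space M - E) *\<^sub>R g 0)"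
    by (intro has_bochner_integral_add has_bochner_integral_scaleR_left has_bochner_integral_real_indicator)
      (auto simp: emeasure_eq_measure)
  then have "has_bochner_integral M (\<lambda>\<omega>. g (X \<omega>)) (prob E *\<^sub>R g 1 + prob (space M - E) *\<^sub>R g 0)"
    by (rule has_bochner_integral_cong[THEN iffD1, rotated -1]) (auto simp: eq)
  then show "(\<integral>\<omega>. g (A \<omega> (fst p) (snd p)) \<partial>M) =
      \<phi> (z (fst p)) (z (snd p)) *\<^sub>R g 1 + (1 - \<phi> (z (fst p)) (z (snd p))) *\<^sub>R g 0"
    "integrable M (\<lambda>\<omega>. g (A \<omega> (fst p) (snd p)))"
    unfolding X_def[symmetric]
    by (auto simp: has_bochner_integral_iff prob_compl prob)
qed

lemma block_value:
  assumes "\<phi> \<in> sbm_params k" "z \<in> labellings n k" "p \<in> node_pairs n"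
  shows "\<phi> (fst (block z p)) (snd (block z p)) = \<phi> (z (fst p)) (z (snd p))"
proof -
  have "fst p < n" "snd p < n" using assms(3) by (auto simp: node_pairs_def)
  then have "z (fst p) < k" "z (snd p) < k"
    using assms(2) by (auto simp: labellings_def)
  then show ?thesis using assms(1) by (auto simp: block_def sbm_params_def min_def max_def)
qed

lemma bernoulli_mass_measurable [measurable]: "(\<lambda>x. bernoulli_mass x q) \<in> borel_measurable borel"
  unfolding bernoulli_mass_def by measurable

lemma block_lik_measurable:
  assumes "sbm M n \<phi> z' A"
  shows "(\<lambda>\<omega>. block_lik n (A \<omega>) \<eta> z) \<in> borel_measurable M"
  unfolding block_lik_def
  by (intro borel_measurable_prod measurable_compose[OF sbm_measurable[OF assms] bernoulli_mass_measurable])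

text \<open>The root of the likelihood ratio is a product of independent factors whose expectations
  are Hellinger affinities. Taking the root is essential: the ratio itself has expectation 1, which
  would make Markov's inequality empty.\<close>

lemma prob_block_lik_ge:
  assumes sbm: "sbm M n \<phi> z' A" and \<phi>: "\<phi> \<in> sbm_params k" "\<forall>a<k. \<forall>b<k. 0 < \<phi> a b \<and> \<phi> a b < 1"
    and z': "z' \<in> labellings n k" and \<eta>: "\<And>q. q \<in> blocks k \<Longrightarrow> 0 \<le> \<eta> q \<and> \<eta> q \<le> 1"
    and z: "z \<in> labellings n k"
  shows "measure M {\<omega> \<in> space M. block_lik n (A \<omega>) \<eta> z \<ge> block_lik n (A \<omega>) (\<lambda>q. \<phi> (fst q) (snd q)) z'}
    \<le> exp (- ((\<Sum>p\<in>node_pairs n. (\<eta> (block z p) - \<phi> (z' (fst p)) (z' (snd p)))\<^sup>2) / 4))"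
proof -
  interpret prob_space M using sbm by (simp add: sbm_def)
  define r where "r p x = sqrt (bernoulli_mass x (\<eta> (block z p)) / bernoulli_mass x (\<phi> (z' (fst p)) (z' (snd p))))"
    for p x
  define R where "R \<omega> = (\<Prod>p\<in>node_pairs n. r p (A \<omega> (fst p) (snd p)))" for \<omega>
  have \<phi>pos: "0 < \<phi> (z' (fst p)) (z' (snd p))" "\<phi> (z' (fst p)) (z' (snd p)) < 1" if "p \<in> node_pairs n" for p
  proof -
    have "fst p < n" "snd p < n" using that by (auto simp: node_pairs_def)
    then have "z' (fst p) < k" "z' (snd p) < k" using z' by (auto simp: labellings_def)
    then show "0 < \<phi> (z' (fst p)) (z' (snd p))" "\<phi> (z' (fst p)) (z' (snd p)) < 1" using \<phi>(2) by auto
  qed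
  have \<eta>': "0 \<le> \<eta> (block z p)" "\<eta> (block z p) \<le> 1" if "p \<in> node_pairs n" for p
    using \<eta> block_in_blocks[OF z that] by auto
  have r_nonneg: "0 \<le> r p x" if "p \<in> node_pairs n" for p x
    using \<phi>pos[OF that] \<eta>'[OF that] by (auto simp: r_def bernoulli_mass_def)
  have r_meas [measurable]: "r p \<in> borel_measurable borel" for p
    unfolding r_def by measurable
  have indep: "indep_vars (\<lambda>_. borel) (\<lambda>p \<omega>. r p (A \<omega> (fst p) (snd p))) (node_pairs n)"
    by (rule indep_vars_compose2[where X = "\<lambda>p \<omega>. A \<omega> (fst p) (snd p)" and M' = "\<lambda>_. borel"])
      (use sbm in \<open>auto simp: sbm_def split_def\<close>)
  have int: "integrable M (\<lambda>\<omega>. r p (A \<omega> (fst p) (snd p)))" if "p \<in> node_pairs n" for p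
    by (rule sbm_expectation(2)[OF sbm that])
  have "expectation R = (\<Prod>p\<in>node_pairs n. expectation (\<lambda>\<omega>. r p (A \<omega> (fst p) (snd p))))"
    unfolding R_def by (rule indep_vars_lebesgue_integral[OF finite_node_pairs indep int])
  also have "\<dots> \<le> (\<Prod>p\<in>node_pairs n. exp (- ((\<eta> (block z p) - \<phi> (z' (fst p)) (z' (snd p)))\<^sup>2 / 4)))"
  proof (rule prod_mono, intro conjI)
    fix p assume p: "p \<in> node_pairs n"
    show "0 \<le> expectation (\<lambda>\<omega>. r p (A \<omega> (fst p) (snd p)))"
      using r_nonneg[OF p] by simp
    define a b where "a = \<eta> (block z p)" and "b = \<phi> (z' (fst p)) (z' (snd p))"
    have ab: "0 \<le> a" "a \<le> 1" "0 < b" "b < 1" using \<eta>'[OF p] \<phi>pos[OF p] by (auto simp: a_def b_def)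
    have c: "x * sqrt (y / x) = sqrt (y * x)" if "0 < x" for x y :: real
      using that by (simp add: real_sqrt_mult real_sqrt_divide field_simps)
    have "expectation (\<lambda>\<omega>. r p (A \<omega> (fst p) (snd p))) = b * sqrt (a / b) + (1 - b) * sqrt ((1 - a) / (1 - b))"
      using sbm_expectation(1)[OF sbm p, of "r p"] by (simp add: r_def bernoulli_mass_def a_def b_def)
    also have "\<dots> = sqrt (a * b) + sqrt ((1 - a) * (1 - b))"
      using ab by (simp add: c)
    also have "\<dots> \<le> exp (- ((a - b)\<^sup>2 / 4))"
      using ab by (intro hellinger_affinity_le) auto
    finally show "expectation (\<lambda>\<omega>. r p (A \<omega> (fst p) (snd p))) \<le>
      exp (- ((\<eta> (block z p) - \<phi> (z' (fst p)) (z' (snd p)))\<^sup>2 / 4))"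
      by (simp add: a_def b_def)
  qed
  also have "\<dots> = exp (- ((\<Sum>p\<in>node_pairs n. (\<eta> (block z p) - \<phi> (z' (fst p)) (z' (snd p)))\<^sup>2) / 4))"
    by (simp add: exp_sum[symmetric] finite_node_pairs sum_negf sum_divide_distrib)
  finally have ER: "expectation R \<le> exp (- ((\<Sum>p\<in>node_pairs n. (\<eta> (block z p) - \<phi> (z' (fst p)) (z' (snd p)))\<^sup>2) / 4))" .
  have "measure M {\<omega> \<in> space M. block_lik n (A \<omega>) \<eta> z \<ge> block_lik n (A \<omega>) (\<lambda>q. \<phi> (fst q) (snd q)) z'}
     \<le> measure M {\<omega> \<in> space M. R \<omega> \<ge> 1}"
  proof (rule finite_measure_mono)
    have [measurable]: "R \<in> borel_measurable M"
      unfolding R_def by (intro borel_measurable_prod measurable_compose[OF sbm_measurable[OF sbm] r_meas])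
    show "{\<omega> \<in> space M. R \<omega> \<ge> 1} \<in> sets M" by measurable
    show "{\<omega> \<in> space M. block_lik n (A \<omega>) \<eta> z \<ge> block_lik n (A \<omega>) (\<lambda>q. \<phi> (fst q) (snd q)) z'}
      \<subseteq> {\<omega> \<in> space M. R \<omega> \<ge> 1}"
    proof clarify
      fix \<omega> assume \<omega>: "\<omega> \<in> space M"
        and ge: "block_lik n (A \<omega>) (\<lambda>q. \<phi> (fst q) (snd q)) z' \<le> block_lik n (A \<omega>) \<eta> z"
      note adj = sbm_adjacency[OF sbm \<omega>]
      have L: "0 < block_lik n (A \<omega>) (\<lambda>q. \<phi> (fst q) (snd q)) z'"
        by (rule block_lik_pos[OF adj z' \<phi>(2)])
      have "block_lik n (A \<omega>) (\<lambda>q. \<phi> (fst q) (snd q)) z' =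
         (\<Prod>p\<in>node_pairs n. bernoulli_mass (A \<omega> (fst p) (snd p)) (\<phi> (z' (fst p)) (z' (snd p))))"
        unfolding block_lik_def by (intro prod.cong refl) (simp add: block_value[OF \<phi>(1) z'])
      then have "R \<omega> = sqrt (block_lik n (A \<omega>) \<eta> z / block_lik n (A \<omega>) (\<lambda>q. \<phi> (fst q) (snd q)) z')"
        unfolding R_def r_def
        by (simp add: block_lik_def[of n "A \<omega>" \<eta>] prod_dividef[symmetric] sqrt_prod)
      then show "1 \<le> R \<omega>" using L ge by simp
    qed
  qed
  also have "\<dots> \<le> expectation R / 1"
  proof (rule integral_Markov_inequality_measure[where A = "{}"])
    show "integrable M R"
      unfolding R_def by (rule indep_vars_integrable[OF finite_node_pairs indep int])
    show "AE x in M. 0 \<le> R x"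
      unfolding R_def by (intro AE_I2 prod_nonneg r_nonneg)
  qed auto
  finally show ?thesis using ER by simp
qed

text \<open>The weight is a product over nodes, so the sum over labellings factorises. Per node, the
  agreeing label contributes at most 1 and all labels together at most \<open>k * exp (- c)\<close>
  on top of that.\<close>

lemma sum_exp_hamming_le:
  fixes c :: real
  shows "(\<Sum>z\<in>labellings n k. exp (- (c * hamming n z y))) \<le> exp (real k * real n * exp (- c))"
proof -
  have "exp (- (c * hamming n z y)) = (\<Prod>i<n. exp (- (c * of_bool (z i \<noteq> y i))))" for z
    by (simp add: hamming_def exp_sum[symmetric] sum_negf sum_distrib_left[symmetric] Int_def)
  then have "(\<Sum>z\<in>labellings n k. exp (- (c * hamming n z y))) =
      (\<Sum>z\<in>{..<n} \<rightarrow>\<^sub>E {..<k}. \<Prod>i<n. exp (- (c * of_bool (z i \<noteq> y i))))"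
    by (simp add: labellings_def)
  also have "\<dots> = (\<Prod>i<n. \<Sum>b<k. exp (- (c * of_bool (b \<noteq> y i))))"
    by (rule prod_sum_PiE[symmetric]) auto
  also have "\<dots> \<le> (\<Prod>i<n. exp (real k * exp (- c)))"
  proof (rule prod_mono, intro conjI)
    fix i
    have "(\<Sum>b<k. exp (- (c * of_bool (b \<noteq> y i)))) \<le> (\<Sum>b<k. of_bool (b = y i) + exp (- c))"
      by (rule sum_mono) auto
    also have "\<dots> \<le> 1 + real k * exp (- c)"
      by (auto simp: sum.distrib of_bool_def)
    also have "\<dots> \<le> exp (real k * exp (- c))" by (rule exp_ge_add_one_self)
    finally show "(\<Sum>b<k. exp (- (c * of_bool (b \<noteq> y i)))) \<le> exp (real k * exp (- c))" .
  qed (auto intro: sum_nonneg)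
  finally show ?thesis by (simp add: exp_of_nat_mult[symmetric] mult_ac)
qed

definition freq_grid :: "nat \<Rightarrow> real set" where
  "freq_grid n = (\<lambda>(x, y). real x / real y) ` {(x, y). x \<le> y \<and> y \<le> n\<^sup>2}"

lemma freq_grid_subset: "{(x, y). x \<le> y \<and> y \<le> N} \<subseteq> {..N} \<times> {..N::nat}"
  by auto

lemma finite_freq_grid [simp]: "finite (freq_grid n)"
  unfolding freq_grid_def by (intro finite_imageI finite_subset[OF freq_grid_subset]) simp

lemma card_freq_grid: "card (freq_grid n) \<le> (n\<^sup>2 + 1)\<^sup>2"
proof -
  have "card (freq_grid n) \<le> card {(x, y). x \<le> y \<and> y \<le> n\<^sup>2}"
    unfolding freq_grid_def by (intro card_image_le finite_subset[OF freq_grid_subset]) simp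
  also have "\<dots> \<le> card ({..n\<^sup>2} \<times> {..n\<^sup>2})"
    by (intro card_mono freq_grid_subset) simp
  finally show ?thesis by (simp add: power2_eq_square)
qed

lemma freq_grid_bounds: "x \<in> freq_grid n \<Longrightarrow> 0 \<le> x \<and> x \<le> 1"
  by (auto simp: freq_grid_def divide_le_eq_1)

lemma block_freq_in_grid:
  assumes "adjacency n A"
  shows "block_freq n A z q \<in> freq_grid n"
proof -
  let ?B = "block_pairs n z q"
  define E where "E = {p\<in>?B. A (fst p) (snd p) = 1}"
  have "block_edges n A z q = (\<Sum>p\<in>?B. of_bool (A (fst p) (snd p) = 1))"
    unfolding block_edges_def
  proof (rule sum.cong[OF refl])
    fix p assume "p \<in> ?B"
    then show "A (fst p) (snd p) = of_bool (A (fst p) (snd p) = 1)"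
      using adjacency_node_pairs[OF assms, of p] by (auto simp: block_pairs_def)
  qed
  then have "block_edges n A z q = real (card E)"
    by (simp add: E_def Int_def)
  moreover have "card E \<le> card ?B" by (rule card_mono) (auto simp: E_def)
  ultimately show ?thesis
    unfolding block_freq_def freq_grid_def
    using card_block_pairs_le[of n z q] by (intro image_eqI[of _ _ "(card E, card ?B)"]) auto
qed

text \<open>Only rational parameters with denominator at most \<open>n\<^sup>2\<close> compete as maximisers, which turns the
  supremum over \<open>\<theta>\<close> into a union bound over polynomially many \<open>\<eta>\<close>.\<close>

definition misfit_event :: "'w measure \<Rightarrow> nat \<Rightarrow> nat \<Rightarrow> (nat \<Rightarrow> nat \<Rightarrow> real) \<Rightarrow> (nat \<Rightarrow> nat) \<Rightarrow>
    ('w \<Rightarrow> nat \<Rightarrow> nat \<Rightarrow> real) \<Rightarrow> 'w set" where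
  "misfit_event M k n \<phi> z' A =
     (\<Union>z\<in>{z \<in> labellings n k. \<not> relabelling k n z z'}. \<Union>\<eta>\<in>blocks k \<rightarrow>\<^sub>E freq_grid n.
        {\<omega> \<in> space M. block_lik n (A \<omega>) (\<lambda>q. \<phi> (fst q) (snd q)) z' \<le> block_lik n (A \<omega>) \<eta> z})"

lemma misfit_event_sets:
  assumes "sbm M n \<phi> z' A"
  shows "misfit_event M k n \<phi> z' A \<in> sets M"
proof -
  note [measurable] = block_lik_measurable[OF assms]
  have [simp]: "finite (blocks k \<rightarrow>\<^sub>E freq_grid n)" by (intro finite_PiE) auto
  show ?thesis
    unfolding misfit_event_def by (intro sets.finite_UN) (simp, simp, measurable)
qed

lemma block_lik_cong:
  assumes "z \<in> labellings n k" "\<And>q. q \<in> blocks k \<Longrightarrow> \<eta> q = \<eta>' q"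
  shows "block_lik n A \<eta> z = block_lik n A \<eta>' z"
  unfolding block_lik_def by (intro prod.cong refl) (simp add: assms block_in_blocks[OF assms(1)])

text \<open>A relabelling of the truth ties with it. For any other \<open>z\<close> the profile
  likelihood stays below the likelihood at the true parameter, which is at most the profile
  likelihood at \<open>z'\<close>.\<close>

lemma max_profile_loglik_outside_misfit:
  assumes sbm: "sbm M n \<phi> z' A" and \<phi>: "\<phi> \<in> sbm_params k" "\<forall>a<k. \<forall>b<k. 0 < \<phi> a b \<and> \<phi> a b < 1"
    and z': "z' \<in> labellings n k" and \<omega>: "\<omega> \<in> space M" "\<omega> \<notin> misfit_event M k n \<phi> z' A"
  shows "(MAX z\<in>labellings n k. profile_loglik k n (A \<omega>) z) = profile_loglik k n (A \<omega>) z'"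
proof (rule Max_eqI)
  note adj = sbm_adjacency[OF sbm \<omega>(1)]
  fix y assume "y \<in> profile_loglik k n (A \<omega>) ` labellings n k"
  then obtain z where z: "z \<in> labellings n k" and y: "y = profile_loglik k n (A \<omega>) z" by auto
  show "y \<le> profile_loglik k n (A \<omega>) z'"
  proof (cases "relabelling k n z z'")
    case True
    then show ?thesis using profile_loglik_relabelling[OF z' True, of "A \<omega>"] y by simp
  next
    case False
    \<comment> \<open>Restriction places the frequencies in the finite extensional function space
      over which \<open>misfit_event\<close> ranges.\<close>
    define \<eta> where "\<eta> = restrict (block_freq n (A \<omega>) z) (blocks k)"
    have "\<eta> \<in> blocks k \<rightarrow>\<^sub>E freq_grid n"
      by (auto simp: \<eta>_def block_freq_in_grid[OF adj])
    then have "block_lik n (A \<omega>) \<eta> z < block_lik n (A \<omega>) (\<lambda>q. \<phi> (fst q) (snd q)) z'"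
      using \<omega> z False by (auto simp: misfit_event_def not_le)
    also have "block_lik n (A \<omega>) \<eta> z = block_lik n (A \<omega>) (block_freq n (A \<omega>) z) z"
      by (rule block_lik_cong[OF z]) (simp add: \<eta>_def)
    also have "\<dots> = exp y" unfolding y by (rule block_lik_freq[OF adj z])
    also have "block_lik n (A \<omega>) (\<lambda>q. \<phi> (fst q) (snd q)) z' = exp (real_of_ereal (sbm_loglik k n (A \<omega>) \<phi> z'))"
      by (rule exp_sbm_loglik[OF adj z' \<phi>(2), symmetric])
    finally have "y \<le> real_of_ereal (sbm_loglik k n (A \<omega>) \<phi> z')" by simp
    moreover have "sbm_loglik k n (A \<omega>) \<phi> z' \<le> ereal (profile_loglik k n (A \<omega>) z')"
      unfolding SUP_sbm_loglik[OF adj, symmetric] using \<phi>(1) by (rule SUP_upper)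
    then have "real_of_ereal (sbm_loglik k n (A \<omega>) \<phi> z') \<le> profile_loglik k n (A \<omega>) z'"
      unfolding sbm_loglik_eq_sum[OF adj z' \<phi>(2)] by simp
    ultimately show ?thesis by simp
  qed
qed (use z' in auto)

text \<open>Union bound. One factor \<open>exp (- c)\<close> is set aside against the polynomially
  many \<open>\<eta>\<close>; the remaining weight in the Hamming distance is summed over
  \<open>z\<close> by \<open>sum_exp_hamming_le\<close>, and \<open>k ^ k\<close> counts the maps
  \<open>\<sigma>\<close>.\<close>

lemma prob_misfit_event_le:
  assumes sbm: "sbm M n \<phi> z' A" and \<phi>: "\<phi> \<in> sbm_params k" "\<forall>a<k. \<forall>b<k. 0 < \<phi> a b \<and> \<phi> a b < 1"
    and z': "z' \<in> labellings n k" and k: "1 \<le> k"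
    and \<delta>: "0 < \<delta>" and sep: "\<And>a b. a < k \<Longrightarrow> b < k \<Longrightarrow> a \<noteq> b \<Longrightarrow> \<exists>c<k. \<delta> \<le> \<bar>\<phi> a c - \<phi> b c\<bar>"
    and m: "1 \<le> m" and size: "\<And>a. a < k \<Longrightarrow> k * m \<le> comm_size n z' a"
    and c: "0 \<le> c" "16 * c \<le> \<delta>\<^sup>2 / 4 * (real m - 1) * (real m / real n)"
  shows "measure M (misfit_event M k n \<phi> z' A) \<le>
    real (k ^ k) * ((real n ^ 2 + 1) ^ (2 * card (blocks k)) * (exp (real k * real n * exp (- c)) * exp (- c)))"
proof -
  interpret prob_space M using sbm by (simp add: sbm_def)
  define Z where "Z = {z \<in> labellings n k. \<not> relabelling k n z z'}"
  define \<Gamma> where "\<Gamma> = (blocks k \<rightarrow>\<^sub>E freq_grid n)"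
  define \<Sigma> where "\<Sigma> = ({..<k} \<rightarrow>\<^sub>E {..<k})"
  \<comment> \<open>The permutation supplied by \<open>misfit_lower_bound\<close> depends on
    \<open>\<eta>\<close>; summing over all maps of the labels makes the bound uniform in
    \<open>\<eta>\<close>.\<close>
  define e where "e z = (\<Sum>\<sigma>\<in>\<Sigma>. exp (- c) * exp (- (c * hamming n z (\<lambda>i. \<sigma> (z' i)))))" for z
  have fin [simp]: "finite Z" "finite \<Gamma>" "finite \<Sigma>"
    by (auto simp: Z_def \<Gamma>_def \<Sigma>_def intro!: finite_PiE)
  define F where "F z \<eta> = {\<omega> \<in> space M. block_lik n (A \<omega>) (\<lambda>q. \<phi> (fst q) (snd q)) z' \<le> block_lik n (A \<omega>) \<eta> z}" for z \<eta>
  have F_sets [measurable]: "F z \<eta> \<in> sets M" for z \<eta>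
    unfolding F_def using block_lik_measurable[OF sbm] by measurable
  have one: "prob (F z \<eta>) \<le> e z" if z: "z \<in> Z" and \<eta>: "\<eta> \<in> \<Gamma>" for z \<eta>
  proof -
    have zl: "z \<in> labellings n k" "\<not> relabelling k n z z'" using z by (auto simp: Z_def)
    define t where "t a b = \<eta> (min a b, max a b)" for a b
    obtain \<sigma> where \<sigma>: "bij_betw \<sigma> {..<k} {..<k}"
      "\<delta>\<^sup>2 / 4 * (real m - 1) * (real m / real n) * real (hamming n z (\<lambda>i. \<sigma> (z' i))) \<le>
      (\<Sum>i<n. \<Sum>j\<in>{..<n} - {i}. (t (z i) (z j) - \<phi> (z' i) (z' j))\<^sup>2)"
      by (rule misfit_lower_bound[OF k zl(1) z' \<delta> sep m size])
    define h where "h = real (hamming n z (\<lambda>i. \<sigma> (z' i)))"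
    \<comment> \<open>Distance 0 would make \<open>z\<close> a relabelling of
      \<open>z'\<close>.\<close>
    have h: "1 \<le> h"
    proof -
      have "\<exists>i<n. z i \<noteq> \<sigma> (z' i)"
        using zl(2) \<sigma>(1) by (auto simp: relabelling_def)
      then have "card {i \<in> {..<n}. z i \<noteq> \<sigma> (z' i)} > 0"
        by (auto simp: card_gt_0_iff)
      then show ?thesis by (simp add: h_def hamming_def)
    qed
    have "(\<Sum>i<n. \<Sum>j\<in>{..<n} - {i}. (t (z i) (z j) - \<phi> (z' i) (z' j))\<^sup>2) =
       2 * (\<Sum>p\<in>node_pairs n. (\<eta> (block z p) - \<phi> (z' (fst p)) (z' (snd p)))\<^sup>2)"
    proof -
      have "\<phi> (z' (snd p)) (z' (fst p)) = \<phi> (z' (fst p)) (z' (snd p))" if "p \<in> node_pairs n" for p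
      proof -
        have "fst p < n" "snd p < n" using that by (auto simp: node_pairs_def)
        then have "z' (fst p) < k" "z' (snd p) < k" using z' by (auto simp: labellings_def)
        then show ?thesis using \<phi>(1) by (auto simp: sbm_params_def)
      qed
      then show ?thesis
        unfolding sum_off_diagonal[of "\<lambda>i j. (t (z i) (z j) - \<phi> (z' i) (z' j))\<^sup>2"] sum_distrib_left
        by (intro sum.cong refl) (simp add: t_def block_def min.commute max.commute)
    qed
    \<comment> \<open>Origin of the 16: the double sum counts each node pair twice and the exponent
      is a quarter of the sum over node pairs, so the exponent is at least \<open>2 * c * h\<close>,
      hence at least \<open>c + c * h\<close>.\<close>
    then have D: "16 * c * h \<le> 2 * (\<Sum>p\<in>node_pairs n. (\<eta> (block z p) - \<phi> (z' (fst p)) (z' (snd p)))\<^sup>2)"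
      using \<sigma>(2) mult_right_mono[OF c(2), of h] h by (simp add: h_def)
    have "prob (F z \<eta>) \<le> exp (- ((\<Sum>p\<in>node_pairs n. (\<eta> (block z p) - \<phi> (z' (fst p)) (z' (snd p)))\<^sup>2) / 4))"
      unfolding F_def
      by (rule prob_block_lik_ge[OF sbm \<phi> z' _ zl(1)]) (use \<eta> freq_grid_bounds in \<open>auto simp: \<Gamma>_def\<close>)
    also have "\<dots> \<le> exp (- c + - (c * h))"
      using D mult_left_mono[OF h c(1)] by simp
    also have "\<dots> = exp (- c) * exp (- (c * hamming n z (\<lambda>i. restrict \<sigma> {..<k} (z' i))))"
    proof -
      have "hamming n z (\<lambda>i. restrict \<sigma> {..<k} (z' i)) = hamming n z (\<lambda>i. \<sigma> (z' i))"
        unfolding hamming_def using z' by (intro arg_cong[of _ _ card]) (auto simp: labellings_def)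
      then show ?thesis by (simp add: h_def exp_add[symmetric])
    qed
    also have "\<dots> \<le> e z"
      unfolding e_def
      by (rule member_le_sum[of _ \<Sigma> "\<lambda>\<sigma>. exp (- c) * exp (- (c * hamming n z (\<lambda>i. \<sigma> (z' i))))"])
        (use \<sigma>(1) fin(3) in \<open>auto simp: \<Sigma>_def bij_betw_def\<close>)
    finally show ?thesis .
  qed
  have "prob (misfit_event M k n \<phi> z' A) = prob (\<Union>p\<in>Z \<times> \<Gamma>. F (fst p) (snd p))"
    unfolding misfit_event_def Z_def[symmetric] \<Gamma>_def[symmetric] F_def[symmetric]
    by (rule arg_cong[of _ _ prob]) fastforce
  also have "\<dots> \<le> (\<Sum>p\<in>Z \<times> \<Gamma>. prob (F (fst p) (snd p)))"
    by (rule finite_measure_subadditive_finite) auto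
  also have "\<dots> \<le> (\<Sum>p\<in>Z \<times> \<Gamma>. e (fst p))"
    by (rule sum_mono) (auto intro: one)
  also have "\<dots> = real (card \<Gamma>) * (\<Sum>z\<in>Z. e z)"
    using sum.cartesian_product[of "\<lambda>z _. e z" \<Gamma> Z] by (simp add: split_def sum_distrib_left)
  also have "\<dots> \<le> (real n ^ 2 + 1) ^ (2 * card (blocks k)) *
      (real (k ^ k) * (exp (- c) * exp (real k * real n * exp (- c))))"
  proof (rule mult_mono)
    have "card \<Gamma> = card (freq_grid n) ^ card (blocks k)"
      by (simp add: \<Gamma>_def card_PiE)
    also have "\<dots> \<le> ((n\<^sup>2 + 1)\<^sup>2) ^ card (blocks k)"
      by (intro power_mono card_freq_grid) simp
    finally have "real (card \<Gamma>) \<le> real (((n\<^sup>2 + 1)\<^sup>2) ^ card (blocks k))"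
      by (simp only: of_nat_le_iff)
    then show "real (card \<Gamma>) \<le> (real n ^ 2 + 1) ^ (2 * card (blocks k))"
      by (simp add: power_mult add.commute)
    have "(\<Sum>z\<in>Z. e z) \<le> (\<Sum>z\<in>labellings n k. e z)"
      by (rule sum_mono2) (auto simp: Z_def e_def intro!: sum_nonneg)
    also have "\<dots> = (\<Sum>\<sigma>\<in>\<Sigma>. exp (- c) * (\<Sum>z\<in>labellings n k. exp (- (c * hamming n z (\<lambda>i. \<sigma> (z' i))))))"
      unfolding e_def by (subst sum.swap) (simp add: sum_distrib_left)
    also have "\<dots> \<le> (\<Sum>\<sigma>\<in>\<Sigma>. exp (- c) * exp (real k * real n * exp (- c)))"
      by (intro sum_mono mult_left_mono sum_exp_hamming_le) simp
    also have "\<dots> = real (k ^ k) * (exp (- c) * exp (real k * real n * exp (- c)))"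
      by (simp add: \<Sigma>_def card_PiE)
    finally show "(\<Sum>z\<in>Z. e z) \<le> real (k ^ k) * (exp (- c) * exp (real k * real n * exp (- c)))" .
  qed (auto intro!: sum_nonneg simp: e_def)
  finally show ?thesis by (simp add: mult_ac)
qed

section \<open>The likelihood ratio within one block\<close>

text \<open>Under the product measure the joint law of the coordinates is the product of their
  marginals, which characterises independence. The common target \<open>L\<close> lets the
  coordinates be treated as \<open>borel\<close> valued.\<close>

lemma indep_vars_PiM_components:
  assumes N: "\<And>i. i \<in> I \<Longrightarrow> prob_space (N i)" "\<And>i. i \<in> I \<Longrightarrow> sets (N i) = sets L" and I: "I \<noteq> {}"
  shows "prob_space.indep_vars (PiM I N) (\<lambda>_. L) (\<lambda>i x. x i) I"
proof -
  interpret P: prob_space "PiM I N" by (rule prob_space_PiM) (rule N)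
  have "P.indep_vars N (\<lambda>i x. x i) I"
  proof (subst P.indep_vars_iff_distr_eq_PiM'[OF I])
    have "distr (PiM I N) (PiM I N) (\<lambda>x. \<lambda>i\<in>I. x i) = distr (PiM I N) (PiM I N) (\<lambda>x. x)"
      by (rule distr_cong) (auto simp: space_PiM PiE_restrict)
    also have "\<dots> = PiM I N" by (rule distr_id2) simp
    also have "\<dots> = PiM I (\<lambda>i. distr (PiM I N) (N i) (\<lambda>x. x i))"
      by (rule PiM_cong) (simp_all add: distr_PiM_component N)
    finally show "distr (PiM I N) (PiM I N) (\<lambda>x. \<lambda>i\<in>I. x i) = PiM I (\<lambda>i. distr (PiM I N) (N i) (\<lambda>x. x i))" .
  qed auto
  then show ?thesis
    by (rule P.indep_vars_compose2[where Y = "\<lambda>_ x. x"]) (auto intro!: measurable_ident_sets N)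
qed

text \<open>A continuous mapping theorem for maps that vary with \<open>n\<close>: Skorohod's
  theorem realises the weak convergence pointwise, and dominated convergence applies because
  \<open>iexp\<close> has modulus 1.\<close>

lemma char_distr_tendsto:
  fixes h :: "nat \<Rightarrow> real \<Rightarrow> real"
  assumes \<mu>: "\<And>n. real_distribution (\<mu> n)" and M: "real_distribution M" and conv: "weak_conv_m \<mu> M"
    and h [measurable]: "\<And>n. h n \<in> borel_measurable borel" "g \<in> borel_measurable borel"
    and lim: "\<And>y x. y \<longlonglongrightarrow> x \<Longrightarrow> (\<lambda>n. h n (y n)) \<longlonglongrightarrow> g x"
  shows "(\<lambda>n. char (distr (\<mu> n) borel (h n)) t) \<longlonglongrightarrow> char (distr M borel g) t"
proof -
  from Skorohod[OF \<mu> M conv] obtain \<Omega> :: "real measure" and Y_seq Y where \<Omega>: "prob_space \<Omega>"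
    and Y_seq: "\<And>n. Y_seq n \<in> measurable \<Omega> borel" "\<And>n. distr \<Omega> borel (Y_seq n) = \<mu> n"
    and Y: "Y \<in> measurable \<Omega> lborel" "distr \<Omega> borel Y = M"
    and Y_lim: "\<And>x. x \<in> space \<Omega> \<Longrightarrow> (\<lambda>n. Y_seq n x) \<longlonglongrightarrow> Y x"
    by blast
  interpret prob_space \<Omega> by (rule \<Omega>)
  note [measurable] = Y_seq(1)
  have [measurable]: "Y \<in> borel_measurable \<Omega>" using Y(1) by simp
  have 1: "char (distr (\<mu> n) borel (h n)) t = (\<integral>x. iexp (t * h n (Y_seq n x)) \<partial>\<Omega>)" for n
    unfolding Y_seq(2)[symmetric] by (simp add: char_def integral_distr)
  have 2: "char (distr M borel g) t = (\<integral>x. iexp (t * g (Y x)) \<partial>\<Omega>)"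
    unfolding Y(2)[symmetric] by (simp add: char_def integral_distr)
  show ?thesis unfolding 1 2
  proof (rule integral_dominated_convergence[where w = "\<lambda>_. 1"])
    show "AE x in \<Omega>. (\<lambda>n. iexp (t * h n (Y_seq n x))) \<longlonglongrightarrow> iexp (t * g (Y x))"
      by (intro AE_I2 tendsto_intros lim Y_lim)
  qed auto
qed

section \<open>The central limit theorem for Bernoulli sums\<close>

definition bernoulli_law :: "real \<Rightarrow> real measure" where
  "bernoulli_law p = distr (measure_pmf (bernoulli_pmf p)) borel of_bool"

text \<open>One fixed i.i.d. sequence to which the central limit theorem applies; the edges of the
  networks form only a triangular array on spaces that vary with \<open>n\<close>.\<close>

definition bernoulli_seq :: "real \<Rightarrow> (nat \<Rightarrow> real) measure" where
  "bernoulli_seq p = PiM UNIV (\<lambda>_. bernoulli_law p)"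

lemma prob_space_bernoulli_law: "prob_space (bernoulli_law p)"
  unfolding bernoulli_law_def by (rule measure_pmf.prob_space_distr) simp

lemma prob_space_bernoulli_seq: "prob_space (bernoulli_seq p)"
  unfolding bernoulli_seq_def by (rule prob_space_PiM) (rule prob_space_bernoulli_law)

lemma bernoulli_seq_component:
  shows "(\<lambda>x. x i) \<in> borel_measurable (bernoulli_seq p)"
    and "distr (bernoulli_seq p) borel (\<lambda>x. x i) = bernoulli_law p"
proof -
  have sets: "sets (bernoulli_law p) = sets borel" by (simp add: bernoulli_law_def)
  have "(\<lambda>x. x i) \<in> measurable (bernoulli_seq p) (bernoulli_law p)"
    unfolding bernoulli_seq_def by (rule measurable_component_singleton) simp
  then show "(\<lambda>x. x i) \<in> borel_measurable (bernoulli_seq p)"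
    using measurable_cong_sets[OF refl sets] by blast
  have "distr (bernoulli_seq p) (bernoulli_law p) (\<lambda>x. x i) = bernoulli_law p"
    unfolding bernoulli_seq_def by (rule distr_PiM_component) (simp_all add: prob_space_bernoulli_law)
  then show "distr (bernoulli_seq p) borel (\<lambda>x. x i) = bernoulli_law p"
    using distr_cong[of "bernoulli_seq p" "bernoulli_seq p" "bernoulli_law p" borel "\<lambda>x. x i" "\<lambda>x. x i"] sets by simp
qed

lemma bernoulli_seq_integral:
  fixes g :: "real \<Rightarrow> 'b :: {banach, second_countable_topology}"
  assumes "0 \<le> p" "p \<le> 1" and [measurable]: "g \<in> borel_measurable borel"
  shows "(\<integral>x. g (x i) \<partial>bernoulli_seq p) = p *\<^sub>R g 1 + (1 - p) *\<^sub>R g 0"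
    and "integrable (bernoulli_seq p) (\<lambda>x. g (x i))"
proof -
  note [measurable] = bernoulli_seq_component(1)
  have "(\<integral>x. g (x i) \<partial>bernoulli_seq p) = (\<integral>x. g x \<partial>distr (bernoulli_seq p) borel (\<lambda>x. x i))"
    by (rule integral_distr[symmetric]) measurable
  also have "\<dots> = (\<integral>b. g (of_bool b) \<partial>measure_pmf (bernoulli_pmf p))"
    unfolding bernoulli_seq_component(2) bernoulli_law_def by (rule integral_distr) auto
  also have "\<dots> = p *\<^sub>R g 1 + (1 - p) *\<^sub>R g 0"
    by (subst integral_measure_pmf[of UNIV]) (auto simp: UNIV_bool assms add.commute)
  finally show "(\<integral>x. g (x i) \<partial>bernoulli_seq p) = p *\<^sub>R g 1 + (1 - p) *\<^sub>R g 0" .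
  have "integrable (measure_pmf (bernoulli_pmf p)) (\<lambda>b. g (of_bool b))"
    by (rule integrable_measure_pmf_finite) simp
  then have "integrable (bernoulli_law p) g"
    unfolding bernoulli_law_def by (subst integrable_distr_eq) auto
  then show "integrable (bernoulli_seq p) (\<lambda>x. g (x i))"
    unfolding bernoulli_seq_component(2)[of p i, symmetric]
    by (subst (asm) integrable_distr_eq) auto
qed

lemma bernoulli_seq_indep:
  "prob_space.indep_vars (bernoulli_seq p) (\<lambda>_. borel) (\<lambda>i x. x i) UNIV"
  unfolding bernoulli_seq_def
  by (rule indep_vars_PiM_components) (simp_all add: prob_space_bernoulli_law, simp add: bernoulli_law_def)

text \<open>Through these characteristic functions the block counts are later identified in law with
  partial sums of \<open>bernoulli_seq\<close>.\<close>

lemma char_bernoulli_sum: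
  fixes p :: real
  assumes "0 \<le> p" "p \<le> 1"
  shows "char (distr (bernoulli_seq p) borel (\<lambda>x. \<Sum>i<N. x i)) t = (p *\<^sub>R iexp t + complex_of_real (1 - p)) ^ N"
proof -
  interpret prob_space "bernoulli_seq p" by (rule prob_space_bernoulli_seq)
  note [measurable] = bernoulli_seq_component(1)
  have "char (distr (bernoulli_seq p) borel (\<lambda>x. \<Sum>i<N. x i)) t =
      (\<Prod>i<N. char (distr (bernoulli_seq p) borel (\<lambda>x. x i)) t)"
    by (rule char_distr_sum) (rule indep_vars_subset[OF bernoulli_seq_indep], simp)
  also have "\<dots> = (\<Prod>i<N. p *\<^sub>R iexp t + complex_of_real (1 - p))"
    using bernoulli_seq_integral(1)[OF assms, of "\<lambda>x. iexp (t * x)"]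
    by (intro prod.cong refl) (simp add: char_def integral_distr scaleR_conv_of_real)
  finally show ?thesis by simp
qed

lemma weak_conv_bernoulli_sum:
  fixes p :: real
  assumes p: "0 < p" "p < 1"
  shows "weak_conv_m (\<lambda>N. distr (bernoulli_seq p) borel (\<lambda>x. ((\<Sum>i<N. x i) - N * p) / sqrt (N * (p * (1 - p)))))
     std_normal_distribution"
proof -
  interpret prob_space "bernoulli_seq p" by (rule prob_space_bernoulli_seq)
  have p': "0 \<le> p" "p \<le> 1" using p by auto
  have pos: "0 < p * (1 - p)" using p by simp
  have mean: "expectation (\<lambda>x. x i) = p" for i
    using bernoulli_seq_integral(1)[OF p', of "\<lambda>x. x"] by simp
  have "variance (\<lambda>x. x i) = p * (1 - p)" for i
    unfolding mean using bernoulli_seq_integral(1)[OF p', of "\<lambda>x. (x - p)\<^sup>2"]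
    by (simp add: power2_eq_square algebra_simps)
  then have var: "variance (\<lambda>x. x i) = (sqrt (p * (1 - p)))\<^sup>2" for i
    using pos by simp
  have "weak_conv_m (\<lambda>N. distr (bernoulli_seq p) borel
      (\<lambda>x. (\<Sum>i<N. x i - p) / sqrt (N * (sqrt (p * (1 - p)))\<^sup>2))) std_normal_distribution"
    by (rule central_limit_theorem[OF bernoulli_seq_indep mean _ _ var bernoulli_seq_component(2)])
      (use pos in \<open>auto intro!: bernoulli_seq_integral(2)[OF p', of "\<lambda>x. x\<^sup>2"]\<close>)
  then show ?thesis
    using pos by (simp add: sum_subtractf)
qed

text \<open>Passes from the number of summands to the block sizes, which tend to infinity but need
  not increase with \<open>n\<close>.\<close>

lemma weak_conv_m_subseq:
  assumes "weak_conv_m \<mu> M" "filterlim f at_top sequentially"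
  shows "weak_conv_m (\<lambda>n. \<mu> (f n)) M"
  using assms unfolding weak_conv_m_def weak_conv_def
  by (auto intro: filterlim_compose)

text \<open>The limit is the second-order Taylor expansion of the Kullback--Leibler divergence at \<open>p\<close>.\<close>

lemma bernoulli_lr_tendsto:
  fixes N :: "nat \<Rightarrow> nat" and p :: real and y :: "nat \<Rightarrow> real"
  assumes p: "0 < p" "p < 1" and N: "filterlim N at_top sequentially" and y: "y \<longlonglongrightarrow> x"
  defines "m \<equiv> \<lambda>n. N n * p + y n * sqrt (N n * (p * (1 - p)))"
  shows "(\<lambda>n. 2 * (bernoulli_loglik (N n) (m n) (m n / N n) - bernoulli_loglik (N n) (m n) p)) \<longlonglongrightarrow> x\<^sup>2"
proof -
  \<comment> \<open>\<open>K d\<close> is the Kullback-Leibler divergence of the Bernoulli law at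
    \<open>p + d\<close> from that at \<open>p\<close>. The function \<open>G\<close> is its
    quotient by \<open>d\<^sup>2\<close>, filled in at 0 by the limit so as to be continuous
    there.\<close>
  define K where "K d = (p + d) * (ln (p + d) - ln p) + (1 - p - d) * (ln (1 - p - d) - ln (1 - p))" for d
  define G where "G d = (if d = 0 then 1 / (2 * p * (1 - p)) else K d / d\<^sup>2)" for d
  have "((\<lambda>d. ((p + d) * (ln (p + d) - ln p) + (q - d) * (ln (q - d) - ln q)) / d\<^sup>2)
      \<longlongrightarrow> 1 / (2 * p) + 1 / (2 * q)) (at 0)" if "0 < q" for q :: real
    using p that by real_asymp (simp_all add: field_simps)
  from this[of "1 - p"] have "((\<lambda>d. K d / d\<^sup>2) \<longlongrightarrow> 1 / (2 * p * (1 - p))) (at 0)"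
    unfolding K_def using p by (simp add: field_simps)
  then have "(G \<longlongrightarrow> 1 / (2 * p * (1 - p))) (at 0)"
    by (rule Lim_transform_eventually) (auto simp: G_def eventually_at_filter)
  then have G: "isCont G 0" by (simp add: isCont_def G_def)
  have KG: "K d = d\<^sup>2 * G d" for d
    by (auto simp: G_def K_def)
  define s where "s = sqrt (p * (1 - p))"
  \<comment> \<open>The deviation of the frequency \<open>m n / N n\<close> from \<open>p\<close>.
    It tends to 0, while \<open>N n * (d n)\<^sup>2 = (y n)\<^sup>2 * s\<^sup>2\<close>
    converges.\<close>
  define d where "d n = y n * s / sqrt (N n)" for n
  have sqrtN: "filterlim (\<lambda>n. sqrt (real (N n))) at_top sequentially"
    by (intro filterlim_compose[OF sqrt_at_top] filterlim_compose[OF filterlim_real_sequentially] N)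
  have d: "d \<longlonglongrightarrow> 0"
    unfolding d_def by (rule tendsto_divide_0[OF tendsto_mult[OF y tendsto_const] filterlim_at_top_imp_at_infinity[OF sqrtN]])
  have "(\<lambda>n. 2 * (y n)\<^sup>2 * s\<^sup>2 * G (d n)) \<longlonglongrightarrow> 2 * x\<^sup>2 * s\<^sup>2 * G 0"
    by (intro tendsto_intros y isCont_tendsto_compose[OF G d])
  also have "2 * x\<^sup>2 * s\<^sup>2 * G 0 = x\<^sup>2"
    using p by (simp add: s_def G_def field_simps)
  finally have "(\<lambda>n. 2 * (y n)\<^sup>2 * s\<^sup>2 * G (d n)) \<longlonglongrightarrow> x\<^sup>2" .
  moreover have "\<forall>\<^sub>F n in sequentially. 1 \<le> N n" using N by (auto simp: filterlim_at_top)
  then have "\<forall>\<^sub>F n in sequentially. 2 * (y n)\<^sup>2 * s\<^sup>2 * G (d n) =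
      2 * (bernoulli_loglik (N n) (m n) (m n / N n) - bernoulli_loglik (N n) (m n) p)"
  proof eventually_elim
    case (elim n)
    then have pos: "0 < real (N n)" by simp
    have m: "m n = N n * (p + d n)"
    proof -
      have "real (N n) * d n = y n * s * (real (N n) / sqrt (N n))" by (simp add: d_def)
      also have "real (N n) / sqrt (N n) = sqrt (N n)" using pos by (simp add: real_div_sqrt)
      finally show ?thesis by (simp add: m_def s_def real_sqrt_mult distrib_left mult_ac)
    qed
    have "bernoulli_loglik (N n) (m n) (m n / N n) - bernoulli_loglik (N n) (m n) p = N n * K (d n)"
    proof -
      have "m n / N n = p + d n" using pos by (simp add: m)
      then show ?thesis unfolding bernoulli_loglik_def K_def by (simp add: m algebra_simps)
    qed
    also have "\<dots> = (y n)\<^sup>2 * s\<^sup>2 * G (d n)"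
      using pos by (simp add: KG d_def power_divide power_mult_distrib)
    finally show ?case by simp
  qed
  ultimately show ?thesis by (rule Lim_transform_eventually)
qed

lemma bernoulli_loglik_measurable [measurable]:
  assumes [measurable]: "f \<in> borel_measurable M" "g \<in> borel_measurable M"
  shows "(\<lambda>x. bernoulli_loglik N (f x) (g x)) \<in> borel_measurable M"
  unfolding bernoulli_loglik_def by measurable

text \<open>The sums \<open>S n\<close> may live on different spaces; only their binomial law enters.\<close>

lemma char_bernoulli_lr_tendsto:
  fixes N :: "nat \<Rightarrow> nat" and p :: real and S :: "nat \<Rightarrow> 'w \<Rightarrow> real"
  assumes p: "0 < p" "p < 1" and N: "filterlim N at_top sequentially"
    and M: "\<And>n. prob_space (M n)" and S: "\<And>n. S n \<in> borel_measurable (M n)"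
    and char_S: "\<And>n t. char (distr (M n) borel (S n)) t = (p *\<^sub>R iexp t + complex_of_real (1 - p)) ^ N n"
  shows "(\<lambda>n. char (distr (M n) borel (\<lambda>\<omega>. 2 * (bernoulli_loglik (N n) (S n \<omega>) (S n \<omega> / N n)
      - bernoulli_loglik (N n) (S n \<omega>) p))) t) \<longlonglongrightarrow> char (distr std_normal_distribution borel (\<lambda>x. x\<^sup>2)) t"
proof -
  note [measurable] = bernoulli_seq_component(1) S
  define \<mu> where "\<mu> N = distr (bernoulli_seq p) borel (\<lambda>x. ((\<Sum>i<N. x i) - real N * p) / sqrt (N * (p * (1 - p))))" for N :: nat
  \<comment> \<open>\<open>h n\<close> undoes the standardisation: from the standardised sum it
    recovers the likelihood ratio statistic of the sum.\<close>
  define h where "h n y = (let m = N n * p + y * sqrt (N n * (p * (1 - p))) in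
      2 * (bernoulli_loglik (N n) m (m / N n) - bernoulli_loglik (N n) m p))" for n y
  have [measurable]: "h n \<in> borel_measurable borel" for n
    unfolding h_def Let_def by measurable
  have rd: "real_distribution (\<mu> n)" for n
    unfolding \<mu>_def by (intro prob_space.real_distribution_distr[OF prob_space_bernoulli_seq]) measurable
  have "(\<lambda>n. char (distr (\<mu> (N n)) borel (h n)) t) \<longlonglongrightarrow> char (distr std_normal_distribution borel (\<lambda>x. x\<^sup>2)) t"
  proof (rule char_distr_tendsto[OF rd real_dist_normal_dist])
    show "weak_conv_m (\<lambda>n. \<mu> (N n)) std_normal_distribution"
      by (rule weak_conv_m_subseq[OF weak_conv_bernoulli_sum[OF p, folded \<mu>_def] N])
    show "(\<lambda>n. h n (y n)) \<longlonglongrightarrow> x\<^sup>2" if "y \<longlonglongrightarrow> x" for y x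
      unfolding h_def Let_def by (rule bernoulli_lr_tendsto[OF p N that])
  qed measurable
  moreover have "\<forall>\<^sub>F n in sequentially. 1 \<le> N n" using N by (auto simp: filterlim_at_top)
  then have "\<forall>\<^sub>F n in sequentially. char (distr (\<mu> (N n)) borel (h n)) t =
     char (distr (M n) borel (\<lambda>\<omega>. 2 * (bernoulli_loglik (N n) (S n \<omega>) (S n \<omega> / N n)
      - bernoulli_loglik (N n) (S n \<omega>) p))) t"
  proof eventually_elim
    case (elim n)
    define u where "u m = 2 * (bernoulli_loglik (N n) m (m / N n) - bernoulli_loglik (N n) m p)" for m
    have [measurable]: "u \<in> borel_measurable borel" unfolding u_def by measurable
    \<comment> \<open>Equal characteristic functions give equal laws, so the statistic may be
      evaluated on \<open>bernoulli_seq\<close> instead of \<open>M n\<close>.\<close>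
    have law: "distr (bernoulli_seq p) borel (\<lambda>x. \<Sum>i<N n. x i) = distr (M n) borel (S n)"
    proof (rule Levy_uniqueness)
      show "real_distribution (distr (bernoulli_seq p) borel (\<lambda>x. \<Sum>i<N n. x i))"
        by (intro prob_space.real_distribution_distr[OF prob_space_bernoulli_seq]) measurable
      show "real_distribution (distr (M n) borel (S n))"
        by (intro prob_space.real_distribution_distr M S)
    qed (use p in \<open>auto simp: char_S char_bernoulli_sum\<close>)
    have "sqrt (N n * (p * (1 - p))) \<noteq> 0" using elim p by simp
    then have "real (N n) * p + (m - real (N n) * p) / sqrt (N n * (p * (1 - p))) * sqrt (N n * (p * (1 - p))) = m" for m
      by (simp only: nonzero_divide_mult_cancel_right nonzero_eq_divide_eq times_divide_eq_left) simp
    then have "h n ((m - real (N n) * p) / sqrt (N n * (p * (1 - p)))) = u m" for m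
      unfolding h_def u_def Let_def by simp
    then have "distr (\<mu> (N n)) borel (h n) = distr (bernoulli_seq p) borel (\<lambda>x. u (\<Sum>i<N n. x i))"
      unfolding \<mu>_def by (subst distr_distr) (auto simp: comp_def)
    also have "\<dots> = distr (distr (bernoulli_seq p) borel (\<lambda>x. \<Sum>i<N n. x i)) borel u"
      by (subst distr_distr) (auto simp: comp_def)
    also have "\<dots> = distr (M n) borel (\<lambda>\<omega>. u (S n \<omega>))"
      unfolding law by (subst distr_distr) (auto simp: comp_def)
    finally show ?case by (simp add: u_def)
  qed
  ultimately show ?thesis by (rule Lim_transform_eventually)
qed

section \<open>Convergence of the statistic\<close>

text \<open>The two distribution functions differ at every point by at most the probability of
  \<open>B n\<close>. This transfers a limit between variables that agree off a negligible
  event.\<close>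

lemma weak_conv_m_modify:
  fixes X Y :: "nat \<Rightarrow> 'w \<Rightarrow> real"
  assumes M: "\<And>n. prob_space (M n)" and [measurable]: "\<And>n. X n \<in> borel_measurable (M n)" "\<And>n. Y n \<in> borel_measurable (M n)"
    and B [measurable]: "\<And>n. B n \<in> sets (M n)"
    and eq: "\<And>n \<omega>. \<omega> \<in> space (M n) \<Longrightarrow> \<omega> \<notin> B n \<Longrightarrow> X n \<omega> = Y n \<omega>"
    and B0: "(\<lambda>n. measure (M n) (B n)) \<longlonglongrightarrow> 0"
    and conv: "weak_conv_m (\<lambda>n. distr (M n) borel (X n)) \<mu>"
  shows "weak_conv_m (\<lambda>n. distr (M n) borel (Y n)) \<mu>"
  unfolding weak_conv_m_def weak_conv_def
proof (intro allI impI)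
  fix x assume "isCont (cdf \<mu>) x"
  then have lim: "(\<lambda>n. cdf (distr (M n) borel (X n)) x) \<longlonglongrightarrow> cdf \<mu> x"
    using conv by (simp add: weak_conv_m_def weak_conv_def)
  have "(\<lambda>n. cdf (distr (M n) borel (Y n)) x - cdf (distr (M n) borel (X n)) x) \<longlonglongrightarrow> 0"
  proof (rule Lim_null_comparison[OF always_eventually B0], rule allI)
    fix n
    interpret prob_space "M n" by (rule M)
    have cdf: "cdf (distr (M n) borel Z) x = prob {\<omega> \<in> space (M n). Z \<omega> \<le> x}"
      if [measurable]: "Z \<in> borel_measurable (M n)" for Z
      unfolding cdf_def by (subst measure_distr) (auto intro!: arg_cong[of _ _ prob])
    have le: "prob {\<omega> \<in> space (M n). U \<omega> \<le> x} \<le> prob {\<omega> \<in> space (M n). V \<omega> \<le> x} + prob (B n)"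
      if [measurable]: "U \<in> borel_measurable (M n)" "V \<in> borel_measurable (M n)"
        and UV: "\<And>\<omega>. \<omega> \<in> space (M n) \<Longrightarrow> \<omega> \<notin> B n \<Longrightarrow> U \<omega> = V \<omega>" for U V :: "'w \<Rightarrow> real"
    proof -
      have "prob {\<omega> \<in> space (M n). U \<omega> \<le> x} \<le> prob ({\<omega> \<in> space (M n). V \<omega> \<le> x} \<union> B n)"
        using UV by (intro finite_measure_mono) auto
      also have "\<dots> \<le> prob {\<omega> \<in> space (M n). V \<omega> \<le> x} + prob (B n)"
        by (rule measure_Un_le) auto
      finally show ?thesis .
    qed
    show "norm (cdf (distr (M n) borel (Y n)) x - cdf (distr (M n) borel (X n)) x) \<le> prob (B n)"
      using le[of "X n" "Y n"] le[of "Y n" "X n"] eq[of _ n] by (simp add: cdf abs_le_iff)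
  qed
  from tendsto_add[OF this lim] show "(\<lambda>n. cdf (distr (M n) borel (Y n)) x) \<longlonglongrightarrow> cdf \<mu> x" by simp
qed

text \<open>The squared coordinates are independent under the product measure, so characteristic
  functions multiply. Positivity of \<open>d\<close> gives the nonempty index set that
  \<open>indep_vars_PiM_components\<close> asks for.\<close>

lemma
  shows real_distribution_chi_square: "real_distribution (chi_square_distribution d)" (is ?A)
    and char_chi_square: "0 < d \<Longrightarrow>
      char (chi_square_distribution d) t = char (distr std_normal_distribution borel (\<lambda>x. x\<^sup>2)) t ^ d" (is "_ \<Longrightarrow> ?B")
proof -
  interpret N: real_distribution std_normal_distribution by (rule real_dist_normal_dist)
  let ?P = "PiM {..<d} (\<lambda>_. std_normal_distribution)"
  interpret P: prob_space ?P by (rule prob_space_PiM) (rule N.prob_space_axioms)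
  have comp: "(\<lambda>x. x i) \<in> measurable ?P std_normal_distribution" if "i < d" for i
    by (rule measurable_component_singleton) (use that in simp)
  then have [measurable]: "(\<lambda>x. x i) \<in> borel_measurable ?P" if "i < d" for i
    using that by simp
  show ?A
    unfolding chi_square_distribution_def
    by (intro P.real_distribution_distr borel_measurable_sum borel_measurable_power) simp
  assume d: "0 < d"
  have "P.indep_vars (\<lambda>_. borel) (\<lambda>i x. x i) {..<d}"
    by (rule indep_vars_PiM_components) (use d N.prob_space_axioms in auto)
  then have "P.indep_vars (\<lambda>_. borel) (\<lambda>i x. (x i)\<^sup>2) {..<d}"
    by (rule P.indep_vars_compose2) simp
  then have "char (chi_square_distribution d) t = (\<Prod>i<d. char (distr ?P borel (\<lambda>x. (x i)\<^sup>2)) t)"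
    unfolding chi_square_distribution_def by (rule P.char_distr_sum)
  also have "\<dots> = (\<Prod>i<d. char (distr std_normal_distribution borel (\<lambda>x. x\<^sup>2)) t)"
  proof (intro prod.cong refl)
    fix i assume "i \<in> {..<d}"
    then have i: "i < d" by simp
    have "distr ?P std_normal_distribution (\<lambda>x. x i) = std_normal_distribution"
      by (rule distr_PiM_component) (use i N.prob_space_axioms in auto)
    then have "distr std_normal_distribution borel (\<lambda>x. x\<^sup>2) =
        distr (distr ?P std_normal_distribution (\<lambda>x. x i)) borel (\<lambda>x. x\<^sup>2)" by simp
    also have "\<dots> = distr ?P borel (\<lambda>x. (x i)\<^sup>2)"
      by (subst distr_distr) (use comp[OF i] in \<open>auto simp: comp_def\<close>)
    finally show "char (distr ?P borel (\<lambda>x. (x i)\<^sup>2)) t = char (distr std_normal_distribution borel (\<lambda>x. x\<^sup>2)) t"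
      by simp
  qed
  finally show ?B by simp
qed

lemma block_edges_measurable:
  assumes "sbm M n \<phi> z' A"
  shows "(\<lambda>\<omega>. block_edges n (A \<omega>) z q) \<in> borel_measurable M"
  unfolding block_edges_def
  by (intro borel_measurable_sum sbm_measurable[OF assms]) (simp add: block_pairs_def)

text \<open>All node pairs of a block share one edge probability, so the count is binomial;
  recording its law by the characteristic function allows comparison across probability
  spaces.\<close>

lemma char_block_edges:
  assumes sbm: "sbm M n \<phi> z A" and \<phi>: "\<phi> \<in> sbm_params k" and z: "z \<in> labellings n k"
  shows "char (distr M borel (\<lambda>\<omega>. block_edges n (A \<omega>) z q)) t =
     (\<phi> (fst q) (snd q) *\<^sub>R iexp t + complex_of_real (1 - \<phi> (fst q) (snd q))) ^ card (block_pairs n z q)"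
proof -
  interpret prob_space M using sbm by (simp add: sbm_def)
  have indep: "indep_vars (\<lambda>_. borel) (\<lambda>p \<omega>. A \<omega> (fst p) (snd p)) (block_pairs n z q)"
    by (rule indep_vars_subset[where I = "node_pairs n"])
      (use sbm in \<open>auto simp: sbm_def split_def block_pairs_def\<close>)
  have "char (distr M borel (\<lambda>\<omega>. block_edges n (A \<omega>) z q)) t =
      (\<Prod>p\<in>block_pairs n z q. char (distr M borel (\<lambda>\<omega>. A \<omega> (fst p) (snd p))) t)"
    unfolding block_edges_def by (rule char_distr_sum[OF indep])
  also have "\<dots> = (\<Prod>p\<in>block_pairs n z q. \<phi> (fst q) (snd q) *\<^sub>R iexp t + complex_of_real (1 - \<phi> (fst q) (snd q)))"
  proof (intro prod.cong refl)
    fix p assume "p \<in> block_pairs n z q"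
    then have p: "p \<in> node_pairs n" and q: "q = block z p" by (auto simp: block_pairs_def)
    show "char (distr M borel (\<lambda>\<omega>. A \<omega> (fst p) (snd p))) t =
      \<phi> (fst q) (snd q) *\<^sub>R iexp t + complex_of_real (1 - \<phi> (fst q) (snd q))"
      unfolding q block_value[OF \<phi> z p]
      using sbm_expectation(1)[OF sbm p, of "\<lambda>x. iexp (t * x)"] sbm_measurable[OF sbm p]
      by (simp add: char_def integral_distr scaleR_conv_of_real)
  qed
  finally show ?thesis by simp
qed

text \<open>Distinct blocks use disjoint sets of node pairs, so their counts are functions of
  disjoint groups of independent entries.\<close>

lemma indep_block_edges:
  assumes sbm: "sbm M n \<phi> z' A"
    and g: "\<And>q. q \<in> Q \<Longrightarrow> g q \<in> borel_measurable borel"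
  shows "prob_space.indep_vars M (\<lambda>_. borel) (\<lambda>q \<omega>. g q (block_edges n (A \<omega>) z q)) Q"
proof -
  interpret prob_space M using sbm by (simp add: sbm_def)
  have "indep_vars (\<lambda>_. borel) (\<lambda>p \<omega>. A \<omega> (fst p) (snd p)) (node_pairs n)"
    using sbm by (simp add: sbm_def split_def)
  then have "indep_vars (\<lambda>q. PiM (block_pairs n z q) (\<lambda>_. borel))
      (\<lambda>q \<omega>. restrict (\<lambda>p. A \<omega> (fst p) (snd p)) (block_pairs n z q)) Q"
    by (rule indep_vars_restrict) (auto simp: block_pairs_def disjoint_family_on_def)
  then have "indep_vars (\<lambda>_. borel)
      (\<lambda>q \<omega>. g q (\<Sum>p\<in>block_pairs n z q. restrict (\<lambda>p. A \<omega> (fst p) (snd p)) (block_pairs n z q) p)) Q"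
    by (rule indep_vars_compose2[where Y = "\<lambda>q x. g q (\<Sum>p\<in>block_pairs n z q. x p)"])
      (auto intro!: measurable_compose[OF _ g] borel_measurable_sum measurable_component_singleton)
  then show ?thesis by (simp add: block_edges_def)
qed

lemma sbm_lr_stat_measurable:
  assumes sbm: "sbm M n \<phi> z' A" and \<phi>: "\<forall>a<k. \<forall>b<k. 0 < \<phi> a b \<and> \<phi> a b < 1" and z': "z' \<in> labellings n k"
  shows "(\<lambda>\<omega>. sbm_lr_stat k n \<phi> z' (A \<omega>)) \<in> borel_measurable M"
proof -
  have ne: "labellings n k \<noteq> {}" using z' by auto
  note [measurable] = block_edges_measurable[OF sbm]
  have [measurable]: "(\<lambda>\<omega>. profile_loglik k n (A \<omega>) z) \<in> borel_measurable M" for z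
    unfolding profile_loglik_def block_freq_def by measurable
  have "(\<lambda>\<omega>. MAX z\<in>labellings n k. profile_loglik k n (A \<omega>) z) \<in> borel_measurable M"
    using borel_measurable_Max[of "labellings n k" "\<lambda>z \<omega>. profile_loglik k n (A \<omega>) z" M] by simp
  then have "(\<lambda>\<omega>. 2 * ((MAX z\<in>labellings n k. profile_loglik k n (A \<omega>) z) -
     (\<Sum>q\<in>blocks k. bernoulli_loglik (card (block_pairs n z' q)) (block_edges n (A \<omega>) z' q) (\<phi> (fst q) (snd q)))))
     \<in> borel_measurable M"
    by measurable
  then show ?thesis
    by (rule measurable_cong[THEN iffD1, rotated])
      (simp add: sbm_lr_stat_def sbm_max_loglik_eq[OF sbm_adjacency[OF sbm] ne]
        sbm_loglik_eq_sum[OF sbm_adjacency[OF sbm] z' \<phi>])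
qed

theorem theorem2:
  fixes k :: nat
    and \<theta>s :: "nat \<Rightarrow> nat \<Rightarrow> real"
    and zs :: "nat \<Rightarrow> nat \<Rightarrow> nat"
    and M :: "nat \<Rightarrow> 'w measure"
    and A :: "nat \<Rightarrow> 'w \<Rightarrow> nat \<Rightarrow> nat \<Rightarrow> real"
  assumes k: "k \<ge> 1"
    and params: "\<theta>s \<in> sbm_params k"
    and labels: "\<And>n. zs n \<in> labellings n k"
    and model: "\<And>n. sbm (M n) n \<theta>s (zs n) (A n)"
    and A1: "\<exists>C1>0. \<forall>\<^sub>F n in sequentially.
               (MIN a\<in>{..<k}. real (comm_size n (zs n) a)) \<ge> C1 * real n / real k"
    and A2: "\<forall>a<k. \<forall>b<k. a \<noteq> b \<longrightarrow> (\<exists>c<k. \<theta>s a c \<noteq> \<theta>s b c)"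
    and A3: "\<exists>\<epsilon>>0. \<forall>a<k. \<forall>b<k. \<epsilon> \<le> \<theta>s a b \<and> \<theta>s a b \<le> 1 - \<epsilon>"
  shows "weak_conv_m
           (\<lambda>n. distr (M n) borel (\<lambda>\<omega>. sbm_lr_stat k n \<theta>s (zs n) (A n \<omega>)))
           (chi_square_distribution (k * (k + 1) div 2))"
proof -
  have M: "prob_space (M n)" for n using model[of n] by (simp add: sbm_def)
  have \<theta>: "\<forall>a<k. \<forall>b<k. 0 < \<theta>s a b \<and> \<theta>s a b < 1"
  proof -
    obtain \<epsilon> where \<epsilon>: "\<epsilon> > 0" "\<forall>a<k. \<forall>b<k. \<epsilon> \<le> \<theta>s a b \<and> \<theta>s a b \<le> 1 - \<epsilon>"
      using A3 by blast
    then show ?thesis by (smt (verit, best))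
  qed
  obtain C1 where C1: "C1 > 0" and ev_min: "\<forall>\<^sub>F n in sequentially.
      (MIN a\<in>{..<k}. real (comm_size n (zs n) a)) \<ge> C1 * real n / real k"
    using A1 by blast
  have ev_size: "\<forall>\<^sub>F n in sequentially. \<forall>a<k. C1 / k * real n \<le> real (comm_size n (zs n) a)"
    using ev_min
  proof eventually_elim
    case (elim n)
    have "(MIN a\<in>{..<k}. real (comm_size n (zs n) a)) \<le> real (comm_size n (zs n) a)" if "a < k" for a
      using that by (intro Min_le) auto
    then show ?case using elim by (auto intro: order_trans)
  qed

  \<comment> \<open>The smallest nonzero gap between two entries of one column, capped at 1. The
    inserted 1 keeps the minimum defined when there is no gap, as for a single community.\<close>
  define \<delta> where "\<delta> = Min (insert 1 ((\<lambda>(a, b, c). \<bar>\<theta>s a c - \<theta>s b c\<bar>) `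
      {(a, b, c). a < k \<and> b < k \<and> c < k \<and> \<theta>s a c \<noteq> \<theta>s b c}))"
  have fin: "finite {(a, b, c). a < k \<and> b < k \<and> c < k \<and> \<theta>s a c \<noteq> \<theta>s b c}"
    by (rule finite_subset[of _ "{..<k} \<times> {..<k} \<times> {..<k}"]) auto
  have \<delta>: "0 < \<delta>" unfolding \<delta>_def using fin by (subst Min_gr_iff) auto
  have sep: "\<exists>c<k. \<delta> \<le> \<bar>\<theta>s a c - \<theta>s b c\<bar>" if ab: "a < k" "b < k" "a \<noteq> b" for a b
  proof -
    obtain c where c: "c < k" "\<theta>s a c \<noteq> \<theta>s b c" using A2 ab by blast
    have "\<delta> \<le> \<bar>\<theta>s a c - \<theta>s b c\<bar>"
      unfolding \<delta>_def using fin ab c by (intro Min_le) (auto intro!: image_eqI[of _ _ "(a, b, c)"])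
    then show ?thesis using c(1) by blast
  qed

  \<comment> \<open>The misfit event is negligible\<close>
  define B where "B n = misfit_event (M n) k n \<theta>s (zs n) (A n)" for n
  have B_sets: "B n \<in> sets (M n)" for n
    unfolding B_def by (rule misfit_event_sets[OF model])
  have B0: "(\<lambda>n. measure (M n) (B n)) \<longlonglongrightarrow> 0"
  proof -
    \<comment> \<open>Chosen so that a cell size \<open>m\<close> of at most
      \<open>2 * \<mu> * n\<close> satisfies \<open>k * m \<le> C1 / k * n\<close>.\<close>
    define \<mu> where "\<mu> = C1 / (2 * real k ^ 2)"
    have \<mu>: "0 < \<mu>" using C1 k by (simp add: \<mu>_def)
    \<comment> \<open>With \<open>\<mu> * n \<le> m - 1\<close> and
      \<open>\<mu> \<le> m / n\<close>, the distance estimate has the factor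
      \<open>\<delta>\<^sup>2 / 4 * \<mu>\<^sup>2 * n\<close>; dividing by the 16 of
      \<open>prob_misfit_event_le\<close> gives the 64.\<close>
    define c where "c = \<delta>\<^sup>2 * \<mu>\<^sup>2 / 64"
    have c: "0 < c" using \<delta> \<mu> by (simp add: c_def)
    define bound where "bound n = real (k ^ k) * ((real n ^ 2 + 1) ^ (2 * card (blocks k)) *
       (exp (real k * real n * exp (- (c * real n))) * exp (- (c * real n))))" for n :: nat
    \<comment> \<open>The last factor beats the polynomial, and
      \<open>k * n * exp (- (c * n))\<close> tends to 0, so the middle exponential tends to
      1.\<close>
    have "(\<lambda>n. (real n ^ 2 + 1) ^ (2 * card (blocks k)) *
       (exp (real k * real n * exp (- (c * real n))) * exp (- (c * real n)))) \<longlonglongrightarrow> 0"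
      using c by real_asymp
    then have bound0: "bound \<longlonglongrightarrow> 0"
      unfolding bound_def by (rule tendsto_mult_right_zero)
    \<comment> \<open>Such \<open>n\<close> absorb the rounding in \<open>m\<close> and the lost
      diagonal: \<open>m - 1 \<ge> 2 * \<mu> * n - 2 \<ge> \<mu> * n\<close>.\<close>
    have "\<forall>\<^sub>F n in sequentially. real n \<ge> 2 / \<mu>"
      by (rule eventually_compose_filterlim[OF eventually_ge_at_top filterlim_real_sequentially])
    with ev_size have "\<forall>\<^sub>F n in sequentially. norm (measure (M n) (B n)) \<le> bound n"
    proof eventually_elim
      case (elim n)
      define m where "m = nat \<lfloor>2 * \<mu> * real n\<rfloor>"
      have \<mu>n: "2 \<le> \<mu> * real n" using elim(2) \<mu> by (simp add: field_simps)
      then have n: "0 < real n" using \<mu> by (cases n) auto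
      have m: "\<mu> * real n \<le> real m - 1" "real m \<le> 2 * \<mu> * real n"
        unfolding m_def using \<mu>n by linarith+
      have "1 \<le> m" using m(1) \<mu>n by linarith
      have size: "k * m \<le> comm_size n (zs n) a" if "a < k" for a
      proof -
        have "real k * real m \<le> real k * (2 * \<mu> * real n)"
          using m(2) by (intro mult_left_mono) auto
        also have "\<dots> = C1 / k * real n"
          using k by (simp add: \<mu>_def power2_eq_square)
        also have "\<dots> \<le> real (comm_size n (zs n) a)" using elim(1) that by blast
        finally show ?thesis by (simp only: of_nat_mult[symmetric] of_nat_le_iff)
      qed
      have "16 * (c * real n) = \<delta>\<^sup>2 / 4 * (\<mu> * real n) * \<mu>"
        by (simp add: c_def power2_eq_square)
      also have "\<dots> \<le> \<delta>\<^sup>2 / 4 * (real m - 1) * (real m / real n)"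
      proof (rule mult_mono)
        show "\<mu> \<le> real m / real n" using m(1) n by (simp add: field_simps)
      qed (use m \<mu> \<mu>n in \<open>auto intro!: mult_left_mono mult_nonneg_nonneg\<close>)
      finally show ?case
        unfolding B_def bound_def
        using prob_misfit_event_le[OF model params \<theta> labels k \<delta> sep \<open>1 \<le> m\<close> size, of "c * real n"] c
        by simp
    qed
    then show ?thesis using bound0 by (rule Lim_null_comparison)
  qed

  \<comment> \<open>The statistic at the true labelling as a sum over blocks\<close>
  define N where "N n q = card (block_pairs n (zs n) q)" for n q
  define E where "E n q \<omega> = block_edges n (A n \<omega>) (zs n) q" for n q \<omega>
  define p where "p q = \<theta>s (fst q) (snd q)" for q :: "nat \<times> nat"
  define g where "g n q x = 2 * (bernoulli_loglik (N n q) x (x / N n q) - bernoulli_loglik (N n q) x (p q))" for n q x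
  define W where "W n \<omega> = (\<Sum>q\<in>blocks k. g n q (E n q \<omega>))" for n \<omega>
  have g_meas [measurable]: "g n q \<in> borel_measurable borel" for n q
    unfolding g_def by measurable
  have E_meas [measurable]: "E n q \<in> borel_measurable (M n)" for n q
    unfolding E_def by (rule block_edges_measurable[OF model])
  have W_meas [measurable]: "W n \<in> borel_measurable (M n)" for n
    unfolding W_def by measurable
  have p: "0 < p q" "p q < 1" if "q \<in> blocks k" for q
    using \<theta> that by (auto simp: p_def blocks_def)

  \<comment> \<open>With \<open>x n = C1 / k * n\<close>, the quantity
    \<open>x n * (x n - 1) / 2\<close> bounds both kinds of block from below; the diagonal blocks
    are the binding case.\<close>
  have N_lim: "filterlim (\<lambda>n. N n q) at_top sequentially" if "q \<in> blocks k" for q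
  proof -
    obtain a b where q: "q = (a, b)" and ab: "a \<le> b" "b < k" "a < k"
      using \<open>q \<in> blocks k\<close> by (auto simp: blocks_def)
    define x where "x n = C1 / k * real n" for n :: nat
    have Ck: "0 < C1 / k" using C1 k by simp
    have "filterlim (\<lambda>n. r * real n * (r * real n - 1) / 2) at_top sequentially" if "0 < r" for r :: real
      using that by real_asymp
    from this[OF Ck] have "filterlim (\<lambda>n. x n * (x n - 1) / 2) at_top sequentially"
      unfolding x_def .
    \<comment> \<open>This ensures \<open>x n \<ge> 1\<close>, so that both factors are nonnegative
      and products can be compared factor by factor.\<close>
    moreover have "\<forall>\<^sub>F n in sequentially. 1 / (C1 / k) \<le> real n"
      by (rule eventually_compose_filterlim[OF eventually_ge_at_top filterlim_real_sequentially])
    with ev_size have "\<forall>\<^sub>F n in sequentially. x n * (x n - 1) / 2 \<le> real (N n q)"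
    proof eventually_elim
      case (elim n)
      have x1: "1 \<le> x n" using elim(2) unfolding pos_divide_le_eq[OF Ck] x_def by (simp only: mult.commute)
      have xa: "x n \<le> comm_size n (zs n) a" "x n \<le> comm_size n (zs n) b"
        using elim(1) ab by (auto simp: x_def)
      have N: "real (N n q) = pair_count n (zs n) a b"
        unfolding N_def q by (rule pair_count_eq_card[OF ab(1), symmetric])
      show ?case
      proof (cases "a = b")
        case True
        have "x n * (x n - 1) \<le> real (comm_size n (zs n) a) * (real (comm_size n (zs n) a) - 1)"
          using xa x1 by (intro mult_mono) auto
        then show ?thesis using True by (simp add: N pair_count_def)
      next
        case False
        have "x n * (x n - 1) / 2 \<le> x n * x n" using x1 by (simp add: field_simps)
        also have "x n * x n \<le> real (comm_size n (zs n) a) * real (comm_size n (zs n) b)"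
          using xa x1 by (intro mult_mono) auto
        finally show ?thesis using False by (simp add: N pair_count_def)
      qed
    qed
    ultimately have "filterlim (\<lambda>n. real (N n q)) at_top sequentially"
      by (rule filterlim_at_top_mono)
    then show ?thesis by (simp add: filterlim_sequentially_iff_filterlim_real)
  qed

  \<comment> \<open>Chi-square limit of the block sum\<close>
  let ?\<chi> = "distr std_normal_distribution borel (\<lambda>x. x\<^sup>2) :: real measure"
  have d: "card (blocks k) = k * (k + 1) div 2" by (rule card_blocks)
  have "0 < card (blocks k)"
  proof -
    have "(0, 0) \<in> blocks k" using k by (simp add: blocks_def)
    then show ?thesis by (auto simp: card_gt_0_iff)
  qed
  have W_conv: "weak_conv_m (\<lambda>n. distr (M n) borel (W n)) (chi_square_distribution (card (blocks k)))"
  proof (rule levy_continuity)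
    show "real_distribution (distr (M n) borel (W n))" for n
      by (intro prob_space.real_distribution_distr M W_meas)
    show "real_distribution (chi_square_distribution (card (blocks k)))"
      by (rule real_distribution_chi_square)
    fix t
    have "char (distr (M n) borel (W n)) t = (\<Prod>q\<in>blocks k. char (distr (M n) borel (\<lambda>\<omega>. g n q (E n q \<omega>))) t)" for n
      unfolding W_def E_def
      by (intro prob_space.char_distr_sum[OF M] indep_block_edges[OF model] g_meas)
    moreover have "(\<lambda>n. \<Prod>q\<in>blocks k. char (distr (M n) borel (\<lambda>\<omega>. g n q (E n q \<omega>))) t)
        \<longlonglongrightarrow> (\<Prod>q\<in>blocks k. char ?\<chi> t)"
    proof (rule tendsto_prod)
      fix q assume q: "q \<in> blocks k"
      show "(\<lambda>n. char (distr (M n) borel (\<lambda>\<omega>. g n q (E n q \<omega>))) t) \<longlonglongrightarrow> char ?\<chi> t"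
        unfolding g_def
        by (rule char_bernoulli_lr_tendsto[OF p[OF q] N_lim[OF q] M E_meas])
          (simp add: E_def[abs_def] N_def p_def char_block_edges[OF model params labels])
    qed
    ultimately show "(\<lambda>n. char (distr (M n) borel (W n)) t) \<longlonglongrightarrow> char (chi_square_distribution (card (blocks k))) t"
      using \<open>0 < card (blocks k)\<close> by (simp add: char_chi_square)
  qed

  \<comment> \<open>Transfer to the likelihood ratio statistic\<close>
  show ?thesis
    unfolding d[symmetric]
  proof (rule weak_conv_m_modify[OF M W_meas _ B_sets _ B0 W_conv])
    show "(\<lambda>\<omega>. sbm_lr_stat k n \<theta>s (zs n) (A n \<omega>)) \<in> borel_measurable (M n)" for n
      by (rule sbm_lr_stat_measurable[OF model \<theta> labels])
    fix n \<omega> assume \<omega>: "\<omega> \<in> space (M n)" "\<omega> \<notin> B n"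
    note adj = sbm_adjacency[OF model \<omega>(1)]
    have ne: "labellings n k \<noteq> {}" using labels[of n] by auto
    have "real_of_ereal (sbm_max_loglik k n (A n \<omega>)) = profile_loglik k n (A n \<omega>) (zs n)"
      unfolding sbm_max_loglik_eq[OF adj ne]
      by (rule max_profile_loglik_outside_misfit[OF model params \<theta> labels \<omega>[unfolded B_def]])
    then show "W n \<omega> = sbm_lr_stat k n \<theta>s (zs n) (A n \<omega>)"
      unfolding sbm_lr_stat_def sbm_loglik_eq_sum[OF adj labels \<theta>]
      by (simp add: profile_loglik_def block_freq_def W_def g_def E_def N_def p_def
          sum_subtractf sum_distrib_left[symmetric])
  qed
qed

end
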